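(* Let $\overline{p}=(p_1,\dots,p_n)\in\mathbb{R}^n$ be a probability vector. (i) Let $\mathcal{A}$ be a $C^*$-algebra. If $a,b,a_i,b_i\in\mathcal{A}$ $(i=1,\dots,n)$, $r\ge 0$ and $s\ge 0$ are such that $\|a_i-a\|\le r$ and $\|b_i-b\|\le s$ for all $i\in\{1,\dots,n\}$, then $$\left\|\sum_{i=1}^n p_ia_i^*b_i-\sum_{i=1}^n p_ia_i^*\cdot\sum_{i=1}^n p_ib_i\right\|\le rs \qquad\text{and}\qquad \left\|\sum_{i=1}^n p_ia_ib_i-\sum_{i=1}^n p_ia_i\cdot\sum_{i=1}^n p_ib_i\right\|\le rs.$$ (ii) Let $X$ be a semi-inner product $C^*$-module, $a\in X$, and $\overline{\alpha}=(\alpha_1,\dots,\alpha_n)\in\mathbb{K}^n$, where $\mathbb{K}=\mathbb{C}$ or $\mathbb{R}$. If $\overline{x}=(x_1,\dots,x_n)\in X^n$ and $r\ge 0$ are such that $\|x_i-a\|\le r$ for all $i\in\{1,\dots,n\}$, then $$\left\|\sum_{i=1}^n p_i\alpha_ix_i-\sum_{i=1}^n p_i\alpha_i\sum_{i=1}^n p_ix_i\right\| \le r\sum_{i=1}^n p_i\left|\alpha_i-\sum_{j=1}^n p_j\alpha_j\right| \le r\left[\sum_{i=1}^n p_i|\alpha_i|^2-\left|\sum_{i=1}^n p_i\alpha_i\right|^2\right]^{1/2}.$$ The constant $1$ in the first and in the second of these inequalities is best possible: for neither of the two inequalities is there a constant $c<1$ such that, after its right-hand side is multiplied by $c$, the inequality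 remains valid for all $C^*$-algebras, all semi-inner product modules $X$ over them, all positive integers $n$, all probability vectors $\overline{p}\in\mathbb{R}^n$, all $a\in X$, all $\overline{\alpha}\in\mathbb{K}^n$, all $\overline{x}=(x_1,\dots,x_n)\in X^n$ and all $r\ge 0$ satisfying $\|x_i-a\|\le r$ for all $i\in\{1,\dots,n\}$.
   Context: A semi-inner product module over a $C^*$-algebra $\mathcal{A}$ (a semi-inner product $C^*$-module) is a right $\mathcal{A}$-module $X$ (as usual, a complex vector space whose scalar multiplication is compatible with the $\mathcal{A}$-action) with a map $\langle\cdot,\cdot\rangle:X\times X\to\mathcal{A}$ such that (i) $\langle x,y+z\rangle=\langle x,y\rangle+\langle x,z\rangle$; (ii) $\langle x,ya\rangle=\langle x,y\rangle a$; (iii) $\langle x,y\rangle^*=\langle y,x\rangle$; (iv) $\langle x,x\rangle\ge 0$, for all $x,y,z\in X$, $a\in\mathcal{A}$. For $x\in X$, $\|x\|=\|\langle x,x\rangle\|^{1/2}$. A probability vector is $\overline{p}=(p_1,\dots,p_n)\in\mathbb{R}^n$ with $p_i\ge 0$ for all $i$ and $\sum_{i=1}^n p_i=1$. *)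

theory Defs
  imports Complex_Main
begin

class scaleC =
  fixes scaleC :: "complex \<Rightarrow> 'a \<Rightarrow> 'a"  (infixr "*\<^sub>C" 75)

class complex_vector = scaleC + real_vector +
  assumes scaleC_add_right: "c *\<^sub>C (x + y) = c *\<^sub>C x + c *\<^sub>C y"
    and scaleC_add_left: "(c + d) *\<^sub>C x = c *\<^sub>C x + d *\<^sub>C x"
    and scaleC_scaleC: "c *\<^sub>C d *\<^sub>C x = (c * d) *\<^sub>C x"
    and scaleC_one: "1 *\<^sub>C x = x"
    and scaleR_scaleC: "r *\<^sub>R x = complex_of_real r *\<^sub>C x"

(* C*-algebras are not required to have a unit. *)
class cstar_algebra = complex_vector + real_normed_algebra + banach +
  fixes adj :: "'a \<Rightarrow> 'a"
  assumes mult_scaleC_left: "(c *\<^sub>C x) * y = c *\<^sub>C (x * y)"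
    and mult_scaleC_right: "x * (c *\<^sub>C y) = c *\<^sub>C (x * y)"
    and norm_scaleC: "norm (c *\<^sub>C x) = cmod c * norm x"
    and adj_adj: "adj (adj x) = x"
    and adj_add: "adj (x + y) = adj x + adj y"
    and adj_scaleC: "adj (c *\<^sub>C x) = cnj c *\<^sub>C adj x"
    and adj_mult: "adj (x * y) = adj y * adj x"
    and cstar_identity: "norm (adj x * x) = (norm x)\<^sup>2"

(* HOL cannot quantify over types inside a formula, so optimality of a constant is stated by failure
   of every smaller constant over this one algebra; this implies failure over all C*-algebras. *)
instantiation complex :: cstar_algebra
begin

definition scaleC_complex :: "complex \<Rightarrow> complex \<Rightarrow> complex"
  where "scaleC_complex c x = c * x"

definition adj_complex :: "complex \<Rightarrow> complex"
  where "adj_complex = cnj"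

instance
  by standard
    (simp_all add: scaleC_complex_def adj_complex_def algebra_simps scaleR_conv_of_real
      norm_mult power2_eq_square)

end

definition cstar_nonneg :: "'a::cstar_algebra \<Rightarrow> bool"
  where "cstar_nonneg a \<longleftrightarrow> (\<exists>b. a = adj b * b)"

(* As the algebra may lack a unit, no unit law is imposed on the right action. *)
locale semi_inner_product_module =
  fixes act :: "'x::complex_vector \<Rightarrow> 'a::cstar_algebra \<Rightarrow> 'x"
    and ip :: "'x \<Rightarrow> 'x \<Rightarrow> 'a"
  assumes act_add_left: "act (x + y) a = act x a + act y a"
    and act_add_right: "act x (a + b) = act x a + act x b"
    and act_mult: "act x (a * b) = act (act x a) b"
    and act_scaleC_left: "act (c *\<^sub>C x) a = c *\<^sub>C act x a"
    and act_scaleC_right: "act x (c *\<^sub>C a) = c *\<^sub>C act x a"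
    and ip_add_right: "ip x (y + z) = ip x y + ip x z"
    and ip_act_right: "ip x (act y a) = ip x y * a"
    and adj_ip: "adj (ip x y) = ip y x"
    and ip_nonneg: "cstar_nonneg (ip x x)"

definition module_norm :: "('x \<Rightarrow> 'x \<Rightarrow> 'a::cstar_algebra) \<Rightarrow> 'x \<Rightarrow> real"
  where "module_norm ip x = sqrt (norm (ip x x))"

(* Vectors of length n are functions on nat of which only the values on {1..n} matter. *)
definition probability_vector :: "nat \<Rightarrow> (nat \<Rightarrow> real) \<Rightarrow> bool"
  where "probability_vector n p \<longleftrightarrow> (\<forall>i\<in>{1..n}. 0 \<le> p i) \<and> (\<Sum>i=1..n. p i) = 1"

end

theory Submission
  imports Defs "HOL-Computational_Algebra.Formal_Power_Series" "HOL-Analysis.Operator_Norm"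
begin

text \<open>
  Subtracting means turns both covariances of the first part into a value of the
  \<open>A\<close>-valued form \<open>\<langle>x, y\<rangle> = \<Sum>i. p i *\<^sub>R (adj (x i) * y i)\<close> on tuples, taken at the centred
  tuples \<open>Q x\<close> and \<open>Q y\<close>. Two facts suffice: the Cauchy-Schwarz inequality
  \<open>\<parallel>\<langle>x, y\<rangle>\<parallel>\<^sup>2 \<le> \<parallel>\<langle>x, x\<rangle>\<parallel> \<parallel>\<langle>y, y\<rangle>\<parallel>\<close>, and that centring does not increase
  \<open>\<parallel>\<langle>x, x\<rangle>\<parallel>\<close>. The second follows from the first, since
  \<open>\<langle>Q x, Q x\<rangle> = \<langle>x - a, Q x\<rangle>\<close> gives \<open>\<parallel>\<langle>Q x, Q x\<rangle>\<parallel> \<le> \<parallel>\<langle>x - a, x - a\<rangle>\<parallel> \<le> r\<^sup>2\<close>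
  (\<open>norm_centred_gram_le\<close>). In a module, Cauchy-Schwarz makes \<open>module_norm\<close> a seminorm, and
  the second part is the triangle inequality for
  \<open>\<Sum>i. p i (\<alpha> i - m) (x i - a)\<close>, \<open>m = \<Sum>i. p i \<alpha> i\<close>, followed by the nonnegativity of the variance
  of \<open>\<bar>\<alpha> i - m\<bar>\<close>. Equality holds throughout for two equal weights and \<open>\<alpha> = x = (1, -1)\<close>
  over the complex numbers.

  The substance is the Cauchy-Schwarz inequality
  (\<open>Cauchy_Schwarz_from_positivity\<close>), which rests on the order of a C*-algebra:
  elements \<open>adj b * b\<close> must form a convex cone on which the norm is monotone. The
  cone is defined here metrically, by \<open>\<parallel>t - a\<parallel> \<le> t\<close> for some \<open>t\<close>, so that its
  convexity is the triangle inequality. The binomial series supplies square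
  roots of its elements (\<open>pos_elem_sqrt\<close>). Whenever \<open>s\<close> and \<open>v\<close> are commuting self-adjoint
  elements with \<open>s\<^sup>2 + v\<^sup>2 = 1\<close>, the element \<open>s + \<i> v\<close> is unitary, whence
  \<open>\<parallel>s\<parallel> \<le> 1\<close>; this replaces the spectral theorem and yields both that squares of self-adjoint
  elements lie in the cone and that the norm is monotone. That every \<open>adj b * b\<close>
  lies in the cone is the theorem of Fukamiya and Kaplansky (\<open>pos_elem_star_square\<close>). These
  arguments take place in a unital algebra; the unitization, with its operator
  norm, carries the conclusions to the general case.
\<close>

section \<open>Complex scalars and the involution\<close>

lemma scaleC_zero_right: "c *\<^sub>C (0::'a::complex_vector) = 0"
proof -
  have "c *\<^sub>C (0::'a) + c *\<^sub>C 0 = c *\<^sub>C 0"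
    by (metis add_0 scaleC_add_right)
  then show ?thesis by simp
qed

lemma scaleC_zero_left: "0 *\<^sub>C (x::'a::complex_vector) = 0"
  using scaleR_scaleC[of 0 x] by simp

lemma scaleC_minus_left: "(- c) *\<^sub>C (x::'a::complex_vector) = - (c *\<^sub>C x)"
proof -
  have "(- c) *\<^sub>C x + c *\<^sub>C x = 0"
    by (metis scaleC_add_left add.left_inverse scaleC_zero_left)
  then show ?thesis by (simp add: eq_neg_iff_add_eq_0)
qed

lemma scaleC_minus_right: "c *\<^sub>C (- x) = - (c *\<^sub>C (x::'a::complex_vector))"
proof -
  have "c *\<^sub>C (- x) + c *\<^sub>C x = 0"
    by (metis scaleC_add_right add.left_inverse scaleC_zero_right)
  then show ?thesis by (simp add: eq_neg_iff_add_eq_0)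
qed

lemma scaleC_diff_right: "c *\<^sub>C (x - y) = c *\<^sub>C x - c *\<^sub>C (y::'a::complex_vector)"
  using scaleC_add_right[of c x "- y"] by (simp add: scaleC_minus_right)

lemma scaleC_diff_left: "(c - d) *\<^sub>C x = c *\<^sub>C x - d *\<^sub>C (x::'a::complex_vector)"
  using scaleC_add_left[of c "- d" x] by (simp add: scaleC_minus_left)

lemma scaleC_sum_right: "c *\<^sub>C (\<Sum>i\<in>A. f i) = (\<Sum>i\<in>A. c *\<^sub>C (f i :: 'a::complex_vector))"
  by (induction A rule: infinite_finite_induct) (auto simp: scaleC_add_right scaleC_zero_right)

lemma scaleC_sum_left: "(\<Sum>i\<in>A. f i) *\<^sub>C x = (\<Sum>i\<in>A. f i *\<^sub>C (x :: 'a::complex_vector))"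
  by (induction A rule: infinite_finite_induct) (auto simp: scaleC_add_left scaleC_zero_left)

lemma adj_scaleR: "adj (r *\<^sub>R (x::'a::cstar_algebra)) = r *\<^sub>R adj x"
  by (simp add: scaleR_scaleC adj_scaleC)

lemma adj_zero [simp]: "adj (0::'a::cstar_algebra) = 0"
  using adj_scaleR[of 0 0] by simp

lemma adj_minus: "adj (- (x::'a::cstar_algebra)) = - adj x"
  using adj_scaleR[of "-1" x] by simp

lemma adj_diff: "adj (x - (y::'a::cstar_algebra)) = adj x - adj y"
  using adj_add[of x "-y"] by (simp add: adj_minus)

lemma adj_sum: "adj (\<Sum>i\<in>A. f i) = (\<Sum>i\<in>A. adj (f i :: 'a::cstar_algebra))"
  by (induction A rule: infinite_finite_induct) (auto simp: adj_add)

lemma norm_adj [simp]: "norm (adj (x::'a::cstar_algebra)) = norm x"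
proof -
  have le: "norm y \<le> norm (adj y)" for y :: 'a
  proof (cases "y = 0")
    case False
    have "norm y * norm y \<le> norm (adj y) * norm y"
      using cstar_identity[of y] norm_mult_ineq[of "adj y" y] by (simp add: power2_eq_square)
    with False show ?thesis by simp
  qed simp
  show ?thesis using le[of x] le[of "adj x"] by (simp add: adj_adj)
qed

lemma bounded_linear_adj: "bounded_linear (adj :: 'a::cstar_algebra \<Rightarrow> 'a)"
  by (rule bounded_linear_intro[where K=1]) (auto simp: adj_add adj_scaleR)

lemma adj_mult_self_eq_0: "adj x * x = 0 \<longleftrightarrow> (x::'a::cstar_algebra) = 0"
  using cstar_identity[of x] by auto

lemma norm_square_selfadjoint: "adj x = x \<Longrightarrow> norm (x * (x::'a::cstar_algebra)) = (norm x)\<^sup>2"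
  using cstar_identity[of x] by simp

lemma adj_one: "adj (1 :: 'b::{cstar_algebra, real_normed_algebra_1}) = 1"
  by (metis adj_adj adj_mult mult_1)

lemma adj_of_real: "adj (of_real r :: 'b::{cstar_algebra, real_normed_algebra_1}) = of_real r"
  by (simp add: of_real_def adj_scaleR adj_one)

section \<open>Square roots by the binomial series\<close>

text \<open>The Taylor coefficients of \<open>sqrt (1 - x)\<close> at 0.\<close>

definition sqrt_coeff :: "nat \<Rightarrow> real"
  where "sqrt_coeff k = (- 1) ^ k * ((1/2) gchoose k)"

lemma sqrt_coeff_0: "sqrt_coeff 0 = 1"
  by (simp add: sqrt_coeff_def)

lemma sqrt_coeff_Suc_nonpos: "sqrt_coeff (Suc k) \<le> 0"
proof -
  have "pochhammer (1/2 :: real) k \<ge> 0" by (rule pochhammer_nonneg) simp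
  then have "pochhammer (- (1/2) :: real) (Suc k) \<le> 0"
    by (simp add: pochhammer_rec)
  then show ?thesis
    by (simp add: sqrt_coeff_def gbinomial_pochhammer flip: power_mult_distrib) (simp add: divide_le_0_iff)
qed

text \<open>The partial sums \<open>\<Sum>k\<le>N. sqrt_coeff k\<close> have the closed form \<open>(-1)^N * (-1/2 gchoose N)\<close>,
  which is nonnegative. As all coefficients but the first are nonpositive, the series
  converges absolutely on the closed unit disc, boundary included; this is what permits
  elements that are not invertible.\<close>

lemma sqrt_coeff_abs_sum_le: "(\<Sum>k<N. \<bar>sqrt_coeff (Suc k)\<bar>) \<le> 1"
proof -
  have "pochhammer (1/2 :: real) N \<ge> 0" by (rule pochhammer_nonneg) simp
  then have "0 \<le> (- 1) ^ N * ((1/2 - 1 :: real) gchoose N)"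
    by (simp add: gbinomial_pochhammer flip: power_mult_distrib)
  also have "\<dots> = (\<Sum>k\<le>N. sqrt_coeff k)"
    unfolding gbinomial_sum_lower_neg[symmetric] by (simp add: sqrt_coeff_def mult.commute)
  also have "\<dots> = 1 + (\<Sum>k<N. sqrt_coeff (Suc k))"
    by (simp add: sum.atMost_shift sqrt_coeff_0)
  also have "(\<Sum>k<N. sqrt_coeff (Suc k)) = - (\<Sum>k<N. \<bar>sqrt_coeff (Suc k)\<bar>)"
    by (simp add: sum_negf[symmetric] abs_of_nonpos[OF sqrt_coeff_Suc_nonpos])
  finally show ?thesis by simp
qed

lemma sqrt_coeff_convolution:
  "(\<Sum>i\<le>k. sqrt_coeff i * sqrt_coeff (k - i)) = (if k = 0 then 1 else if k = 1 then -1 else 0)"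
proof -
  have "(\<Sum>i\<le>k. sqrt_coeff i * sqrt_coeff (k - i))
      = (\<Sum>i\<le>k. (-1) ^ k * (((1/2) gchoose i) * ((1/2) gchoose (k - i))))"
    by (intro sum.cong refl)
      (simp add: sqrt_coeff_def mult.assoc mult.left_commute flip: power_add)
  also have "\<dots> = (-1) ^ k * (1 gchoose k)"
    using gbinomial_Vandermonde[of "1/2 :: real" "1/2" k]
    by (simp add: atMost_atLeast0 flip: sum_distrib_left)
  also have "1 gchoose k = (of_nat (1 choose k) :: real)"
    by (metis binomial_gbinomial of_nat_1)
  finally show ?thesis by (cases k; cases "k - 1") auto
qed

text \<open>The root is the power series in \<open>h\<close>, so it inherits self-adjointness and the
  commutant of \<open>h\<close>. The bound on \<open>1 - s\<close> is the bound on the coefficients; it makes the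
  root itself positive.\<close>

lemma unital_sqrt:
  fixes h :: "'b::{cstar_algebra, real_normed_algebra_1}"
  assumes h: "norm h \<le> 1" and sa: "adj h = h"
  obtains s where "adj s = s" "s * s = 1 - h" "norm (1 - s) \<le> 1"
    "\<And>x. x * h = h * x \<Longrightarrow> x * s = s * x"
proof
  let ?f = "\<lambda>k. sqrt_coeff k *\<^sub>R h ^ k"
  define s where "s = (\<Sum>k. ?f k)"
  have hk: "norm (h ^ k) \<le> 1" for k
    using norm_power_ineq[of h k] power_le_one[of "norm h" k] h by simp
  have le: "norm (?f k) \<le> \<bar>sqrt_coeff k\<bar>" for k
    using hk[of k] by (simp add: mult_left_le)
  have sc': "summable (\<lambda>k. \<bar>sqrt_coeff (Suc k)\<bar>)"
    by (rule summableI_nonneg_bounded[where x=1]) (auto simp: sqrt_coeff_abs_sum_le)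
  then have sc: "summable (\<lambda>k. \<bar>sqrt_coeff k\<bar>)" by (subst (asm) summable_Suc_iff)
  have sn: "summable (\<lambda>k. norm (?f k))"
    by (rule summable_comparison_test'[OF sc]) (use le in auto)
  then have sf: "summable ?f" by (rule summable_norm_cancel)
  have adjp: "adj (h ^ k) = h ^ k" for k
  proof (induction k)
    case 0
    then show ?case by (simp add: adj_one)
  next
    case (Suc k)
    then show ?case by (metis adj_mult power_Suc power_Suc2 sa)
  qed
  show "adj s = s"
    unfolding s_def by (subst bounded_linear.suminf[OF bounded_linear_adj sf]) (simp add: adj_scaleR adjp)
  have "s * s = (\<Sum>k. \<Sum>i\<le>k. ?f i * ?f (k - i))"
    unfolding s_def by (rule Cauchy_product[OF sn sn])
  also have "\<dots> = (\<Sum>k. (if k = 0 then 1 else if k = 1 then -1 else 0) *\<^sub>R h ^ k)"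
    by (intro suminf_cong)
      (simp flip: sqrt_coeff_convolution add: scaleR_sum_left power_add[symmetric] mult.commute)
  also have "\<dots> = (\<Sum>k\<in>{0,1}. (if k = 0 then 1 else if k = 1 then -1 else 0) *\<^sub>R h ^ k)"
    by (rule suminf_finite) auto
  also have "\<dots> = 1 - h" by simp
  finally show "s * s = 1 - h" .
  have "1 - s = - (\<Sum>k. ?f (Suc k))"
    unfolding s_def by (subst suminf_split_head[OF sf]) (simp add: sqrt_coeff_0)
  also have "norm \<dots> \<le> (\<Sum>k. \<bar>sqrt_coeff (Suc k)\<bar>)"
    unfolding norm_minus_cancel
    by (rule norm_suminf_le[OF le sc'])
  also have "\<dots> \<le> 1"
    by (rule suminf_le_const[OF sc' sqrt_coeff_abs_sum_le])
  finally show "norm (1 - s) \<le> 1" .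
  fix x assume x: "x * h = h * x"
  have "x * h ^ k = h ^ k * x" for k
    by (rule power_commuting_commutes[OF x[symmetric], symmetric])
  then show "x * s = s * x"
    unfolding s_def suminf_mult[OF sf, symmetric] suminf_mult2[OF sf] by simp
qed


lemma unital_sqrt_scaled:
  fixes a :: "'b::{cstar_algebra, real_normed_algebra_1}"
  assumes sa: "adj a = a" and t: "0 \<le> t" "norm (of_real t - a) \<le> t"
  obtains s where "adj s = s" "s * s = a" "norm (of_real (sqrt t) - s) \<le> sqrt t"
    "\<And>x. x * a = a * x \<Longrightarrow> x * s = s * x"
proof (cases "t = 0")
  case True
  then show ?thesis using t by (intro that[of 0]) auto
next
  case False
  with t have t0: "t > 0" by simp
  define h where "h = 1 - (1/t) *\<^sub>R a"
  have th: "of_real t - a = t *\<^sub>R h"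
    using t0 by (simp add: h_def of_real_def algebra_simps)
  have "norm h \<le> 1" using t t0 unfolding th by simp
  moreover have "adj h = h" by (simp add: h_def adj_diff adj_scaleR sa adj_one)
  ultimately obtain s where s: "adj s = s" "s * s = 1 - h" "norm (1 - s) \<le> 1"
    "\<And>x. x * h = h * x \<Longrightarrow> x * s = s * x" using unital_sqrt by metis
  show ?thesis
  proof (rule that[of "sqrt t *\<^sub>R s"])
    show "adj (sqrt t *\<^sub>R s) = sqrt t *\<^sub>R s" by (simp add: adj_scaleR s)
    show "sqrt t *\<^sub>R s * sqrt t *\<^sub>R s = a" using t0 by (simp add: s(2) h_def)
    have "of_real (sqrt t) - sqrt t *\<^sub>R s = sqrt t *\<^sub>R (1 - s)"
      by (simp add: of_real_def algebra_simps)
    then show "norm (of_real (sqrt t) - sqrt t *\<^sub>R s) \<le> sqrt t"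
      using s(3) t0 by (simp add: mult_left_le)
    fix x assume "x * a = a * x"
    then have "x * h = h * x" by (simp add: h_def algebra_simps)
    from s(4)[OF this] show "x * sqrt t *\<^sub>R s = sqrt t *\<^sub>R s * x" by simp
  qed
qed

section \<open>The positive cone of a unital algebra\<close>

text \<open>For self-adjoint \<open>a\<close> the norm condition says that the spectrum of \<open>a\<close> lies in
  \<open>[0, 2t]\<close>, so this is the usual positive cone, in a form that does not mention spectra.\<close>

definition pos_elem :: "'b::{cstar_algebra, real_normed_algebra_1} \<Rightarrow> bool"
  where "pos_elem a \<longleftrightarrow> adj a = a \<and> (\<exists>t\<ge>0. norm (of_real t - a) \<le> t)"

lemma pos_elem_selfadjoint: "pos_elem a \<Longrightarrow> adj a = a"
  by (simp add: pos_elem_def)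

lemma pos_elem_add:
  assumes "pos_elem a" "pos_elem b"
  shows "pos_elem (a + b)"
proof -
  obtain t u where t: "0 \<le> t" "norm (of_real t - a) \<le> t" and u: "0 \<le> u" "norm (of_real u - b) \<le> u"
    using assms unfolding pos_elem_def by blast
  have "norm (of_real (t + u) - (a + b)) = norm ((of_real t - a) + (of_real u - b))"
    by (simp add: algebra_simps)
  also have "\<dots> \<le> t + u" using t u by (intro norm_triangle_le) simp
  finally show ?thesis
    using assms t u unfolding pos_elem_def by (metis adj_add add_nonneg_nonneg)
qed

lemma pos_elem_scaleR:
  assumes "pos_elem a" "0 \<le> c"
  shows "pos_elem (c *\<^sub>R a)"
proof -
  obtain t where t: "0 \<le> t" "norm (of_real t - a) \<le> t" using assms unfolding pos_elem_def by blast
  have "norm (of_real (c * t) - c *\<^sub>R a) = norm (c *\<^sub>R (of_real t - a))"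
    by (simp add: of_real_def scaleR_diff_right)
  also have "\<dots> \<le> c * t" using t assms by (simp add: mult_left_mono)
  finally show ?thesis
    using assms t unfolding pos_elem_def by (metis adj_scaleR mult_nonneg_nonneg)
qed

lemma pos_elem_sqrt:
  assumes "pos_elem a"
  obtains s where "pos_elem s" "s * s = a" "\<And>x. x * a = a * x \<Longrightarrow> x * s = s * x"
proof -
  obtain t where t: "0 \<le> t" "norm (of_real t - a) \<le> t" and sa: "adj a = a"
    using assms unfolding pos_elem_def by blast
  obtain s where s: "adj s = s" "s * s = a" "norm (of_real (sqrt t) - s) \<le> sqrt t"
    "\<And>x. x * a = a * x \<Longrightarrow> x * s = s * x"
    using unital_sqrt_scaled[OF sa t] by metis
  from s(1,3) t have "pos_elem s"
    unfolding pos_elem_def by (metis real_sqrt_ge_zero)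
  then show ?thesis using s(2,4) that by blast
qed

text \<open>The element \<open>s + \<i> v\<close> is \<open>sqrt M\<close> times a unitary, and \<open>s\<close> is its real part.\<close>

lemma norm_le_of_sum_squares:
  fixes s v :: "'b::{cstar_algebra, real_normed_algebra_1}"
  assumes sa: "adj s = s" "adj v = v" and comm: "s * v = v * s"
    and sum: "s * s + v * v = of_real M" and M: "0 \<le> M"
  shows "(norm s)\<^sup>2 \<le> M"
proof -
  define u where "u = s + \<i> *\<^sub>C v"
  have adju: "adj u = s - \<i> *\<^sub>C v"
    by (simp add: u_def adj_add adj_scaleC sa scaleC_minus_left)
  have "adj u * u = s * s + v * v"
    by (simp add: adju) (simp add: u_def algebra_simps mult_scaleC_left mult_scaleC_right scaleC_scaleC
        scaleC_minus_left scaleC_diff_right scaleC_one comm)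
  then have "(norm u)\<^sup>2 = M"
    using sum M by (simp flip: cstar_identity)
  moreover have "2 *\<^sub>R s = u + adj u" by (simp add: adju) (simp add: u_def scaleR_2)
  then have "2 * norm s = norm (u + adj u)" by (metis norm_scaleR abs_numeral)
  then have "norm s \<le> norm u" using norm_triangle_ineq[of u "adj u"] by simp
  then have "(norm s)\<^sup>2 \<le> (norm u)\<^sup>2" by (simp add: power_mono)
  ultimately show ?thesis by simp
qed

text \<open>With \<open>v\<^sup>2 = M - a\<^sup>2\<close>, the pair \<open>v\<close>, \<open>a\<close> satisfies the hypotheses of
  \<open>norm_le_of_sum_squares\<close>, which now bounds \<open>v\<close>.\<close>

lemma norm_diff_square_le:
  fixes a :: "'b::{cstar_algebra, real_normed_algebra_1}"
  assumes sa: "adj a = a" and M: "(norm a)\<^sup>2 \<le> M"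
  shows "norm (of_real M - a * a) \<le> M"
proof -
  have M0: "0 \<le> M" using M by (meson order_trans zero_le_power2)
  have "norm (of_real M - (of_real M - a * a)) \<le> M"
    using M by (simp add: norm_square_selfadjoint sa)
  moreover have "adj (of_real M - a * a) = of_real M - a * a"
    by (simp add: adj_diff adj_mult sa adj_of_real)
  ultimately obtain v where v: "adj v = v" "v * v = of_real M - a * a"
    "\<And>x. x * (of_real M - a * a) = (of_real M - a * a) * x \<Longrightarrow> x * v = v * x"
    using unital_sqrt_scaled[OF _ M0] by metis
  have "a * of_real M = of_real M * a" by (simp add: of_real_def)
  then have "a * v = v * a" by (intro v(3)) (simp add: algebra_simps)
  then have "(norm v)\<^sup>2 \<le> M"
    by (intro norm_le_of_sum_squares[OF v(1) sa _ _ M0]) (auto simp: v(2))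
  then show ?thesis by (simp add: norm_square_selfadjoint v(1) flip: v(2))
qed

lemma pos_elem_square:
  assumes "adj a = a"
  shows "pos_elem (a * a)"
  unfolding pos_elem_def
proof (intro conjI exI)
  show "adj (a * a) = a * a" by (simp add: adj_mult assms)
  show "0 \<le> (norm a)\<^sup>2" by simp
  show "norm (of_real ((norm a)\<^sup>2) - a * a) \<le> (norm a)\<^sup>2"
    by (rule norm_diff_square_le[OF assms order_refl])
qed

text \<open>Membership in the cone asserts \<open>\<parallel>t - a\<parallel> \<le> t\<close> for one \<open>t\<close> only. Passing to a
  square root of \<open>a\<close> gives it for every \<open>t\<close> that is at least the norm of \<open>a\<close>.\<close>

lemma pos_elem_norm_diff:
  assumes "pos_elem a" "norm a \<le> M"
  shows "norm (of_real M - a) \<le> M"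
proof -
  obtain s where s: "pos_elem s" "s * s = a" using pos_elem_sqrt[OF assms(1)] by metis
  then show ?thesis
    using norm_diff_square_le[of s M] assms(2) norm_square_selfadjoint[of s]
    by (auto simp: pos_elem_selfadjoint)
qed

lemma pos_elem_diff_of_real:
  assumes "pos_elem a" "norm a \<le> M"
  shows "pos_elem (of_real M - a)"
proof -
  have "norm (of_real M - (of_real M - a)) \<le> M" "0 \<le> M"
    using assms norm_ge_zero[of a] by (auto simp del: norm_ge_zero)
  then show ?thesis
    using assms unfolding pos_elem_def by (auto simp: adj_diff adj_of_real)
qed

text \<open>If \<open>M\<close> is the norm of \<open>a + b\<close>, then \<open>M - a = (M - (a + b)) + b\<close> is positive, so \<open>a\<close> and
  \<open>M - a\<close> have commuting square roots, whose squares add up to \<open>M\<close>.\<close>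

lemma pos_elem_norm_mono:
  assumes a: "pos_elem a" and b: "pos_elem b"
  shows "norm a \<le> norm (a + b)"
proof -
  define M where "M = norm (a + b)"
  have "pos_elem (of_real M - (a + b))"
    by (rule pos_elem_diff_of_real[OF pos_elem_add[OF a b]]) (simp add: M_def)
  from pos_elem_add[OF this b] have "pos_elem (of_real M - a)" by simp
  then obtain v where v: "pos_elem v" "v * v = of_real M - a"
    "\<And>x. x * (of_real M - a) = (of_real M - a) * x \<Longrightarrow> x * v = v * x"
    using pos_elem_sqrt by metis
  obtain s where s: "pos_elem s" "s * s = a" using pos_elem_sqrt[OF a] by metis
  have "s * a = a * s" by (simp add: mult.assoc flip: s(2))
  moreover have "s * of_real M = of_real M * s" by (simp add: of_real_def)
  ultimately have "s * v = v * s" by (intro v(3)) (simp add: algebra_simps)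
  then have "(norm s)\<^sup>2 \<le> M"
    using s v(1,2) by (intro norm_le_of_sum_squares[of s v]) (auto simp: pos_elem_selfadjoint M_def)
  then show ?thesis
    using norm_square_selfadjoint[of s] s by (simp add: pos_elem_selfadjoint M_def)
qed

text \<open>Put \<open>p = - (adj c * c)\<close>. Since \<open>adj c * c + c * adj c\<close> is a sum of squares of self-adjoint
  elements, \<open>c * adj c\<close> is positive. The usual proof now compares
  the nonzero spectra of the two products, which agree. Here the norms decide:
  with \<open>M = \<parallel>p\<parallel> = \<parallel>c\<parallel>\<^sup>2\<close>, compressing \<open>M - c * adj c\<close>, of norm at most \<open>M\<close>, by \<open>c\<close> gives
  \<open>\<parallel>M p + p\<^sup>2\<parallel> \<le> M\<^sup>2\<close>, whereas \<open>p\<^sup>2 \<le> M p\<close> gives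
  \<open>\<parallel>M p + p\<^sup>2\<parallel> \<ge> 2 \<parallel>p\<^sup>2\<parallel> = 2 M\<^sup>2\<close>; hence \<open>M = 0\<close>.\<close>

lemma no_negative_star_square:
  assumes neg: "pos_elem (- (adj c * c))"
  shows "c = 0"
proof -
  define p where "p = - (adj c * c)"
  define M where "M = (norm c)\<^sup>2"
  have p: "pos_elem p" using neg by (simp add: p_def)
  have pM: "norm p = M" by (simp add: p_def M_def cstar_identity)
  obtain w where w: "pos_elem w" "w * w = p" using pos_elem_sqrt[OF p] by metis
  \<comment> \<open>twice the real part of \<open>c\<close> and, up to sign, twice its imaginary part\<close>
  define x where "x = c + adj c"
  define y where "y = \<i> *\<^sub>C (c - adj c)"
  have xy: "adj x = x" "adj y = y"
    by (simp_all add: x_def y_def adj_add adj_diff adj_adj adj_scaleC scaleC_minus_left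
        scaleC_diff_right add.commute)
  have "x * x + y * y = 2 *\<^sub>R (c * adj c) + 2 *\<^sub>R (adj c * c)"
    by (simp add: x_def y_def algebra_simps mult_scaleC_left mult_scaleC_right scaleC_scaleC
        scaleC_minus_left scaleC_diff_right scaleC_one scaleR_2)
  then have "c * adj c = (1/2) *\<^sub>R (x * x + y * y) + p"
    by (simp add: p_def scaleR_add_right)
  then have q: "pos_elem (c * adj c)"
    using p xy by (simp add: pos_elem_add pos_elem_scaleR pos_elem_square)
  have "norm (c * adj c) \<le> M"
    using cstar_identity[of "adj c"] by (simp add: M_def adj_adj)
  from pos_elem_norm_diff[OF q this] have qM: "norm (of_real M - c * adj c) \<le> M" .
  have "M *\<^sub>R p + p * p = - (adj c * ((of_real M - c * adj c) * c))"
    by (simp add: p_def of_real_def algebra_simps)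
  then have "norm (M *\<^sub>R p + p * p) \<le> norm (adj c) * (norm (of_real M - c * adj c) * norm c)"
    by (simp del: norm_adj) (meson norm_mult_ineq mult_left_mono norm_ge_zero order_trans)
  also have "\<dots> \<le> norm (adj c) * (M * norm c)"
    using qM by (intro mult_mono mult_nonneg_nonneg) (auto simp: M_def)
  also have "\<dots> = M\<^sup>2" by (simp add: M_def power2_eq_square)
  finally have le: "norm (M *\<^sub>R p + p * p) \<le> M\<^sup>2" .
  have "pos_elem (of_real M - p)" by (rule pos_elem_diff_of_real[OF p]) (simp add: pM)
  then obtain v where v: "pos_elem v" "v * v = of_real M - p"
    "\<And>x. x * (of_real M - p) = (of_real M - p) * x \<Longrightarrow> x * v = v * x"
    using pos_elem_sqrt by metis
  have "w * p = p * w" by (simp add: mult.assoc flip: w(2))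
  moreover have "w * of_real M = of_real M * w" by (simp add: of_real_def)
  ultimately have wv: "w * v = v * w" by (intro v(3)) (simp add: algebra_simps)
  \<comment> \<open>\<open>M p - p\<^sup>2 = w (M - p) w\<close> is positive, because \<open>w\<close> commutes with the root of \<open>M - p\<close>\<close>
  have "(w * v) * (w * v) = w * (v * v) * w" by (subst (2) wv) (simp add: mult.assoc)
  also have "\<dots> = M *\<^sub>R p - p * p"
    by (simp add: v(2) w(2)[symmetric] of_real_def algebra_simps)
  finally have "pos_elem (M *\<^sub>R p - p * p)"
    using pos_elem_square[of "w * v"] v(1) w(1) wv by (simp add: adj_mult pos_elem_selfadjoint)
  moreover have "pos_elem (2 *\<^sub>R (p * p))"
    using p by (intro pos_elem_scaleR pos_elem_square) (auto simp: pos_elem_selfadjoint)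
  ultimately have "norm (2 *\<^sub>R (p * p)) \<le> norm (M *\<^sub>R p + p * p)"
    using pos_elem_norm_mono[of "2 *\<^sub>R (p * p)" "M *\<^sub>R p - p * p"] by (simp add: scaleR_2 algebra_simps)
  then have "2 * M\<^sup>2 \<le> M\<^sup>2"
    using le order_trans by (fastforce simp: norm_square_selfadjoint pos_elem_selfadjoint[OF p] pM)
  then show ?thesis by (simp add: M_def)
qed

text \<open>Let \<open>a = adj b * b\<close>, let \<open>m = \<bar>a\<bar>\<close> be the positive root of \<open>a\<^sup>2\<close>, and let
  \<open>d = m - a\<close>, twice the negative part of \<open>a\<close>. Then \<open>a d = - m d\<close>, so that
  \<open>adj (b * d) * (b * d) = d a d = - d m d\<close> is the negative of a positive element. By
  \<open>no_negative_star_square\<close>, \<open>b d = 0\<close>; this forces \<open>d = 0\<close> and \<open>a = m\<close>.\<close>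

theorem pos_elem_star_square: "pos_elem (adj b * b)"
proof -
  define a where "a = adj b * b"
  have sa: "adj a = a" by (simp add: a_def adj_mult adj_adj)
  obtain m where m: "pos_elem m" "m * m = a * a" "\<And>x. x * (a * a) = (a * a) * x \<Longrightarrow> x * m = m * x"
    using pos_elem_sqrt[OF pos_elem_square[OF sa]] by metis
  have am: "a * m = m * a" by (rule m(3)) (simp add: mult.assoc)
  obtain r where r: "pos_elem r" "r * r = m" "\<And>x. x * m = m * x \<Longrightarrow> x * r = r * x"
    using pos_elem_sqrt[OF m(1)] by metis
  define d where "d = m - a"
  have dsa: "adj d = d" using sa m(1) by (simp add: d_def adj_diff pos_elem_selfadjoint)
  have "d * m = m * d" by (simp add: d_def algebra_simps am)
  then have dr: "d * r = r * d" by (rule r(3))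
  have ad: "a * d = - (m * d)" by (simp add: d_def algebra_simps am m(2))
  have "adj (b * d) * (b * d) = d * (a * d)" by (simp add: a_def adj_mult dsa mult.assoc)
  also have "\<dots> = - ((d * r) * (d * r))"
    unfolding ad r(2)[symmetric] by (simp add: dr mult.assoc) (metis dr mult.assoc)
  finally have *: "- (adj (b * d) * (b * d)) = (d * r) * (d * r)" by simp
  have "pos_elem ((d * r) * (d * r))"
    by (rule pos_elem_square) (simp add: adj_mult dsa r(1) pos_elem_selfadjoint dr)
  then have bd: "b * d = 0" using * by (intro no_negative_star_square) simp
  have "a * d = 0" by (simp add: a_def mult.assoc bd)
  moreover from this have "m * d = 0" using ad by simp
  ultimately have "adj d * d = 0" unfolding dsa by (simp add: d_def algebra_simps)
  then have "d = 0" by (simp add: adj_mult_self_eq_0)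
  then show ?thesis using m(1) by (simp add: d_def a_def)
qed

lemma pos_elem_conjugate:
  assumes "pos_elem a"
  shows "pos_elem (adj c * a * c)"
proof -
  obtain s where s: "pos_elem s" "s * s = a" using pos_elem_sqrt[OF assms] by metis
  have "adj c * a * c = adj (s * c) * (s * c)"
    using s by (simp add: adj_mult pos_elem_selfadjoint mult.assoc flip: s(2))
  then show ?thesis by (simp add: pos_elem_star_square)
qed


section \<open>Unitization\<close>

text \<open>The pair of \<open>t\<close> and \<open>a\<close> stands for the formal sum \<open>t 1 + a\<close>.\<close>

datatype 'a unitization = Unitize (scalar_part: complex) (alg_part: 'a)

definition left_mult :: "'a::cstar_algebra unitization \<Rightarrow> 'a \<Rightarrow> 'a"
  where "left_mult u x = scalar_part u *\<^sub>C x + alg_part u * x"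

lemma norm_left_mult_le: "norm (left_mult u x) \<le> (cmod (scalar_part u) + norm (alg_part u)) * norm x"
proof -
  have "norm (left_mult u x) \<le> norm (scalar_part u *\<^sub>C x) + norm (alg_part u * x)"
    unfolding left_mult_def by (rule norm_triangle_ineq)
  also have "\<dots> \<le> cmod (scalar_part u) * norm x + norm (alg_part u) * norm x"
    by (intro add_mono norm_mult_ineq) (simp add: norm_scaleC)
  finally show ?thesis by (simp add: algebra_simps)
qed

lemma bounded_linear_left_mult: "bounded_linear (left_mult u)"
proof (rule bounded_linear_intro)
  fix x y :: 'a and r :: real
  show "left_mult u (x + y) = left_mult u x + left_mult u y"
    by (simp add: left_mult_def scaleC_add_right algebra_simps)
  show "left_mult u (r *\<^sub>R x) = r *\<^sub>R left_mult u x"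
    by (simp add: left_mult_def scaleR_add_right scaleR_scaleC scaleC_scaleC mult.commute
        mult_scaleC_right scaleC_add_right)
  show "norm (left_mult u x) \<le> norm x * (cmod (scalar_part u) + norm (alg_part u))"
    using norm_left_mult_le[of u x] by (simp only: mult.commute)
qed

lemma onorm_left_mult_le: "onorm (left_mult u) \<le> cmod (scalar_part u) + norm (alg_part u)"
  by (rule onorm_bound) (simp_all add: norm_left_mult_le)

text \<open>Evaluating the operator at the adjoint of the algebra part \<open>a\<close> recovers \<open>\<parallel>a\<parallel>\<close>, since
  \<open>\<parallel>a * adj a\<parallel> = \<parallel>a\<parallel>\<^sup>2\<close>. This makes the norm below definite and
  complete, and makes the embedding of the algebra isometric.\<close>

lemma norm_alg_part_le: "norm (alg_part u) \<le> cmod (scalar_part u) + onorm (left_mult u)"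
proof (cases "alg_part u = 0")
  case True
  then show ?thesis by (simp add: onorm_pos_le bounded_linear_left_mult)
next
  case False
  define a where "a = alg_part u"
  have "norm a * norm a = norm (a * adj a)"
    using cstar_identity[of "adj a"] by (simp add: adj_adj power2_eq_square)
  also have "\<dots> = norm (left_mult u (adj a) - scalar_part u *\<^sub>C adj a)"
    by (simp add: left_mult_def a_def)
  also have "\<dots> \<le> norm (left_mult u (adj a)) + norm (scalar_part u *\<^sub>C adj a)"
    by (rule norm_triangle_ineq4)
  also have "\<dots> \<le> onorm (left_mult u) * norm a + cmod (scalar_part u) * norm a"
    using onorm[OF bounded_linear_left_mult, of u "adj a"] by (simp add: norm_scaleC)
  finally have "norm a * norm a \<le> (cmod (scalar_part u) + onorm (left_mult u)) * norm a"
    by (simp add: algebra_simps)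
  with False show ?thesis by (simp add: a_def)
qed

text \<open>If the algebra already has a unit \<open>e\<close>, then the formal difference \<open>1 - e\<close> acts as zero, and
  the operator norm alone is only a seminorm. The maximum with the scalar character
  repairs this without affecting the C*-identity.\<close>

instantiation unitization :: (cstar_algebra) real_normed_algebra_1
begin

definition "0 = Unitize 0 0"
definition "1 = Unitize 1 0"
definition "u + v = Unitize (scalar_part u + scalar_part v) (alg_part u + alg_part v)"
definition "u - v = Unitize (scalar_part u - scalar_part v) (alg_part u - alg_part v)"
definition "- u = Unitize (- scalar_part u) (- alg_part u)"
definition "r *\<^sub>R u = Unitize (r *\<^sub>R scalar_part u) (r *\<^sub>R alg_part u)"
definition "u * v = Unitize (scalar_part u * scalar_part v)
  (scalar_part u *\<^sub>C alg_part v + scalar_part v *\<^sub>C alg_part u + alg_part u * alg_part v)"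
definition "norm u = max (cmod (scalar_part u)) (onorm (left_mult u))"
definition "sgn (u :: 'a unitization) = inverse (norm u) *\<^sub>R u"
definition "dist u (v :: 'a unitization) = norm (u - v)"
definition "(uniformity :: ('a unitization \<times> 'a unitization) filter)
  = (INF e\<in>{0<..}. principal {(u, v). dist u v < e})"
definition "open (U :: 'a unitization set)
  \<longleftrightarrow> (\<forall>u\<in>U. eventually (\<lambda>(u', v). u' = u \<longrightarrow> v \<in> U) uniformity)"

lemmas unitization_simps = zero_unitization_def one_unitization_def plus_unitization_def
  minus_unitization_def uminus_unitization_def scaleR_unitization_def times_unitization_def

instance
proof
  fix u v w :: "'a unitization" and r q :: real
  show "u + v + w = u + (v + w)" "u + v = v + u" "0 + u = u" "- u + u = 0" "u - v = u + - v"
    by (simp_all add: unitization_simps)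
  show "r *\<^sub>R (u + v) = r *\<^sub>R u + r *\<^sub>R v" "(r + q) *\<^sub>R u = r *\<^sub>R u + q *\<^sub>R u"
    "r *\<^sub>R q *\<^sub>R u = (r * q) *\<^sub>R u" "1 *\<^sub>R u = u"
    by (simp_all add: unitization_simps algebra_simps)
  show "u * v * w = u * (v * w)" "(u + v) * w = u * w + v * w" "u * (v + w) = u * v + u * w"
    by (simp_all add: unitization_simps algebra_simps scaleC_add_right scaleC_add_left scaleC_scaleC
        mult_scaleC_left mult_scaleC_right)
  show "r *\<^sub>R u * v = r *\<^sub>R (u * v)" "u * r *\<^sub>R v = r *\<^sub>R (u * v)"
    by (simp_all add: unitization_simps scaleR_scaleC scaleC_complex_def scaleC_add_right
        scaleC_scaleC mult_scaleC_left mult_scaleC_right mult_ac)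
  show "1 * u = u" "u * 1 = u" "(0 :: 'a unitization) \<noteq> 1"
    by (simp_all add: unitization_simps scaleC_one scaleC_zero_right)
  show "dist u v = norm (u - v)" "sgn u = inverse (norm u) *\<^sub>R u"
    by (simp_all add: dist_unitization_def sgn_unitization_def)
  show "(uniformity :: ('a unitization \<times> 'a unitization) filter)
      = (INF e\<in>{0<..}. principal {(u, v). dist u v < e})"
    by (rule uniformity_unitization_def)
  show "open U \<longleftrightarrow> (\<forall>u\<in>U. eventually (\<lambda>(u', v). u' = u \<longrightarrow> v \<in> U) uniformity)"
    for U :: "'a unitization set" by (rule open_unitization_def)
  have bl: "bounded_linear (left_mult u)" for u :: "'a unitization" by (rule bounded_linear_left_mult)
  have nn: "0 \<le> onorm (left_mult u)" for u :: "'a unitization" by (rule onorm_pos_le[OF bl])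
  show "norm u = 0 \<longleftrightarrow> u = 0"
  proof
    assume "norm u = 0"
    then have "cmod (scalar_part u) \<le> 0" "onorm (left_mult u) \<le> 0"
      by (auto simp: norm_unitization_def max_def split: if_splits)
    then have "cmod (scalar_part u) \<le> 0" "norm (alg_part u) \<le> 0"
      using norm_alg_part_le[of u] by linarith+
    then have "scalar_part u = 0" "alg_part u = 0" by simp_all
    then show "u = 0" by (cases u) (simp add: unitization_simps)
  next
    assume "u = 0"
    moreover have "onorm (left_mult (0 :: 'a unitization)) \<le> 0"
      using onorm_left_mult_le[of "0 :: 'a unitization"] by (simp add: unitization_simps)
    ultimately show "norm u = 0"
      using nn[of u] by (simp add: norm_unitization_def unitization_simps)
  qed
  have "left_mult (u + v) = (\<lambda>x. left_mult u x + left_mult v x)"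
    by (simp add: fun_eq_iff left_mult_def unitization_simps scaleC_add_left algebra_simps)
  then have "onorm (left_mult (u + v)) \<le> onorm (left_mult u) + onorm (left_mult v)"
    by (simp add: onorm_triangle bl)
  moreover have "cmod (scalar_part (u + v)) \<le> cmod (scalar_part u) + cmod (scalar_part v)"
    by (simp add: plus_unitization_def norm_triangle_ineq)
  ultimately show "norm (u + v) \<le> norm u + norm v"
    unfolding norm_unitization_def by linarith
  have "left_mult (r *\<^sub>R u) = (\<lambda>x. r *\<^sub>R left_mult u x)"
    by (simp add: fun_eq_iff left_mult_def unitization_simps scaleR_scaleC scaleC_scaleC
        scaleC_add_right mult_scaleC_left scaleC_complex_def)
  then have "onorm (left_mult (r *\<^sub>R u)) = \<bar>r\<bar> * onorm (left_mult u)"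
    by (simp add: onorm_scaleR bl)
  then show "norm (r *\<^sub>R u) = \<bar>r\<bar> * norm u"
    unfolding norm_unitization_def max_mult_distrib_left by (simp add: scaleR_unitization_def)
  have "left_mult (u * v) = left_mult u \<circ> left_mult v"
    by (simp add: fun_eq_iff left_mult_def unitization_simps scaleC_add_left scaleC_add_right
        scaleC_scaleC algebra_simps mult_scaleC_left mult_scaleC_right)
  then have "onorm (left_mult (u * v)) \<le> onorm (left_mult u) * onorm (left_mult v)"
    by (simp add: onorm_compose bl)
  also have "\<dots> \<le> norm u * norm v"
    by (intro mult_mono nn) (auto simp: norm_unitization_def le_max_iff_disj)
  finally have "onorm (left_mult (u * v)) \<le> norm u * norm v" .
  moreover have "cmod (scalar_part (u * v)) \<le> norm u * norm v"
    unfolding times_unitization_def unitization.sel norm_mult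
    by (intro mult_mono) (auto simp: norm_unitization_def le_max_iff_disj)
  ultimately show "norm (u * v) \<le> norm u * norm v"
    by (simp add: norm_unitization_def[of "u * v"])
  have "onorm (left_mult (1 :: 'a unitization)) \<le> 1"
    using onorm_left_mult_le[of "1 :: 'a unitization"] by (simp add: unitization_simps)
  then show "norm (1 :: 'a unitization) = 1"
    by (simp add: norm_unitization_def) (simp add: unitization_simps max_def)
qed

end

lemma norm_scalar_part_le: "cmod (scalar_part u) \<le> norm u"
  by (simp add: norm_unitization_def)

lemma norm_alg_part_le_norm: "norm (alg_part u) \<le> 2 * norm u"
  using norm_alg_part_le[of u] by (simp add: norm_unitization_def max_def split: if_splits)

lemma norm_unitization_le: "norm u \<le> cmod (scalar_part u) + norm (alg_part u)"
  using onorm_left_mult_le[of u] by (simp add: norm_unitization_def)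

instance unitization :: (cstar_algebra) banach
proof
  fix X :: "nat \<Rightarrow> 'a unitization"
  assume X: "Cauchy X"
  have "bounded_linear (scalar_part :: 'a unitization \<Rightarrow> _)"
    by (rule bounded_linear_intro[where K=1])
      (auto simp: norm_scalar_part_le plus_unitization_def scaleR_unitization_def)
  then have "Cauchy (\<lambda>n. scalar_part (X n))" by (rule bounded_linear.Cauchy[OF _ X])
  then obtain t where t: "(\<lambda>n. scalar_part (X n)) \<longlonglongrightarrow> t"
    by (auto simp: Cauchy_convergent_iff convergent_def)
  have "bounded_linear (alg_part :: 'a unitization \<Rightarrow> _)"
    by (rule bounded_linear_intro[where K=2])
      (use norm_alg_part_le_norm in \<open>auto simp: plus_unitization_def scaleR_unitization_def mult.commute\<close>)
  then have "Cauchy (\<lambda>n. alg_part (X n))" by (rule bounded_linear.Cauchy[OF _ X])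
  then obtain a where a: "(\<lambda>n. alg_part (X n)) \<longlonglongrightarrow> a"
    by (auto simp: Cauchy_convergent_iff convergent_def)
  have lim: "(\<lambda>n. cmod (scalar_part (X n) - t) + norm (alg_part (X n) - a)) \<longlonglongrightarrow> 0"
    using tendsto_add[OF tendsto_norm[OF LIM_zero[OF t]] tendsto_norm[OF LIM_zero[OF a]]] by simp
  have le: "norm (X n - Unitize t a) \<le> cmod (scalar_part (X n) - t) + norm (alg_part (X n) - a)" for n
    using norm_unitization_le[of "X n - Unitize t a"] by (simp add: minus_unitization_def)
  have "(\<lambda>n. norm (X n - Unitize t a)) \<longlonglongrightarrow> 0"
    by (rule tendsto_sandwich[OF _ _ tendsto_const lim]) (simp_all only: le norm_ge_zero eventually_True)
  then have "(\<lambda>n. X n - Unitize t a) \<longlonglongrightarrow> 0" by (rule tendsto_norm_zero_cancel)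
  then show "convergent X" unfolding convergent_def by (blast dest: LIM_zero_cancel)
qed

instantiation unitization :: (cstar_algebra) cstar_algebra
begin

definition "c *\<^sub>C u = Unitize (c * scalar_part u) (c *\<^sub>C alg_part u)"
definition "adj u = Unitize (cnj (scalar_part u)) (adj (alg_part u))"

instance
proof
  fix u v :: "'a unitization" and c d :: complex and r :: real
  note simps = unitization_simps scaleC_unitization_def adj_unitization_def
  show "c *\<^sub>C (u + v) = c *\<^sub>C u + c *\<^sub>C v" "(c + d) *\<^sub>C u = c *\<^sub>C u + d *\<^sub>C u"
    "c *\<^sub>C d *\<^sub>C u = (c * d) *\<^sub>C u" "1 *\<^sub>C u = u"
    by (simp_all add: simps algebra_simps scaleC_add_right scaleC_add_left scaleC_scaleC scaleC_one)
  show "r *\<^sub>R u = complex_of_real r *\<^sub>C u"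
    by (simp add: simps scaleR_conv_of_real) (simp add: scaleR_scaleC)
  show "c *\<^sub>C u * v = c *\<^sub>C (u * v)" "u * c *\<^sub>C v = c *\<^sub>C (u * v)"
    by (simp_all add: simps scaleC_add_right scaleC_scaleC mult_scaleC_left mult_scaleC_right mult_ac)
  show "adj (adj u) = u" "adj (u + v) = adj u + adj v" "adj (c *\<^sub>C u) = cnj c *\<^sub>C adj u"
    by (simp_all add: simps adj_adj adj_add adj_scaleC)
  show "adj (u * v) = adj v * adj u"
    by (simp add: simps adj_add adj_scaleC adj_mult add.commute)
  have bl: "bounded_linear (left_mult u)" for u :: "'a unitization" by (rule bounded_linear_left_mult)
  have "onorm (left_mult (c *\<^sub>C u)) \<le> cmod c * onorm (left_mult u)" for c and u :: "'a unitization"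
  proof (rule onorm_bound)
    fix x
    have "left_mult (c *\<^sub>C u) x = c *\<^sub>C left_mult u x"
      by (simp add: left_mult_def simps scaleC_add_right scaleC_scaleC mult_scaleC_left)
    then show "norm (left_mult (c *\<^sub>C u) x) \<le> cmod c * onorm (left_mult u) * norm x"
      using onorm[OF bl, of u x] by (simp add: norm_scaleC mult.assoc mult_left_mono)
  qed (simp add: onorm_pos_le bl)
  then have "onorm (left_mult (c *\<^sub>C u)) \<le> cmod c * norm u" for c and u :: "'a unitization"
    by (rule order_trans) (simp add: norm_unitization_def mult_left_mono)
  moreover have "cmod (scalar_part (c *\<^sub>C u)) \<le> cmod c * norm u" for c and u :: "'a unitization"
    by (simp add: scaleC_unitization_def norm_mult mult_left_mono norm_scalar_part_le)
  ultimately have scaleC_le: "norm (c *\<^sub>C u) \<le> cmod c * norm u" for c and u :: "'a unitization"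
    by (simp add: norm_unitization_def[of "c *\<^sub>C u"])
  show "norm (c *\<^sub>C u) = cmod c * norm u"
  proof (cases "c = 0")
    case True
    then show ?thesis using scaleC_le[of c u] by simp
  next
    case False
    have "u = inverse c *\<^sub>C c *\<^sub>C u" using False by (cases u) (simp add: simps scaleC_scaleC scaleC_one)
    then have "norm u \<le> cmod (inverse c) * norm (c *\<^sub>C u)" using scaleC_le[of "inverse c" "c *\<^sub>C u"] by simp
    with False have "cmod c * norm u \<le> norm (c *\<^sub>C u)" by (simp add: norm_divide field_simps)
    then show ?thesis using scaleC_le[of c u] by simp
  qed
  \<comment> \<open>the operator \<open>left_mult u\<close> has the formal adjoint \<open>left_mult (adj u)\<close>: the square of \<open>\<parallel>u x\<parallel>\<close> is \<open>\<parallel>adj x (adj u * u) x\<parallel>\<close>\<close>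
  have le: "(norm u)\<^sup>2 \<le> norm (adj u * u)" for u :: "'a unitization"
  proof -
    have "norm (left_mult u x) \<le> sqrt (norm (adj u * u)) * norm x" for x
    proof -
      have "(norm (left_mult u x))\<^sup>2 = norm (adj x * left_mult (adj u * u) x)"
        by (simp add: cstar_identity[symmetric])
          (simp add: left_mult_def simps adj_add adj_scaleC adj_mult mult_scaleC_left mult_scaleC_right
            scaleC_add_left scaleC_add_right scaleC_scaleC algebra_simps)
      also have "\<dots> \<le> norm x * norm (left_mult (adj u * u) x)"
        using norm_mult_ineq[of "adj x" "left_mult (adj u * u) x"] by simp
      also have "\<dots> \<le> norm x * (onorm (left_mult (adj u * u)) * norm x)"
        by (intro mult_left_mono onorm bl) simp
      also have "\<dots> \<le> norm x * (norm (adj u * u) * norm x)"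
        by (intro mult_left_mono mult_right_mono) (auto simp: norm_unitization_def)
      also have "\<dots> = (sqrt (norm (adj u * u)) * norm x)\<^sup>2"
        by (simp add: power_mult_distrib) (simp add: power2_eq_square)
      finally show ?thesis by (rule power2_le_imp_le) simp
    qed
    then have "onorm (left_mult u) \<le> sqrt (norm (adj u * u))" by (intro onorm_bound) auto
    moreover have "(cmod (scalar_part u))\<^sup>2 \<le> norm (adj u * u)"
      using norm_scalar_part_le[of "adj u * u"] by (simp add: simps norm_mult power2_eq_square)
    then have "cmod (scalar_part u) \<le> sqrt (norm (adj u * u))" by (rule real_le_rsqrt)
    ultimately have "norm u \<le> sqrt (norm (adj u * u))" by (simp add: norm_unitization_def[of u])
    then show ?thesis using power_mono[of "norm u" _ 2] by fastforce
  qed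
  have le': "norm u \<le> norm (adj u)" for u :: "'a unitization"
  proof (cases "u = 0")
    case False
    have "norm u * norm u \<le> norm (adj u) * norm u"
      using le[of u] norm_mult_ineq[of "adj u" u] by (simp add: power2_eq_square)
    with False show ?thesis by simp
  qed simp
  have "norm (adj u) = norm u"
    using le'[of u] le'[of "adj u"] \<open>adj (adj u) = u\<close> by simp
  then have "norm (adj u * u) \<le> (norm u)\<^sup>2"
    using norm_mult_ineq[of "adj u" u] by (simp add: power2_eq_square)
  with le[of u] show "norm (adj u * u) = (norm u)\<^sup>2" by simp
qed

end

definition embed :: "'a::cstar_algebra \<Rightarrow> 'a unitization"
  where "embed = Unitize 0"

lemma embed_add: "embed (a + b) = embed a + embed b"
  and embed_diff: "embed (a - b) = embed a - embed b"
  and embed_mult: "embed (a * b) = embed a * embed b"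
  and embed_scaleR: "embed (r *\<^sub>R a) = r *\<^sub>R embed a"
  and embed_adj: "embed (adj a) = adj (embed a)"
  by (simp_all add: embed_def unitization_simps adj_unitization_def scaleC_zero_left)

lemma norm_embed [simp]: "norm (embed a) = norm a"
  using norm_unitization_le[of "embed a"] norm_alg_part_le[of "embed a"]
    onorm_pos_le[OF bounded_linear_left_mult, of "embed a"]
  by (simp add: norm_unitization_def embed_def)


section \<open>The Cauchy-Schwarz inequality\<close>

lemma pos_elem_embed_star_square: "pos_elem (embed (adj a * a))"
  by (simp add: embed_mult embed_adj pos_elem_star_square)

lemma pos_elem_embed_cstar_nonneg: "cstar_nonneg a \<Longrightarrow> pos_elem (embed a)"
  by (auto simp: cstar_nonneg_def pos_elem_embed_star_square)

lemma embed_zero [simp]: "embed 0 = 0"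
  by (simp add: embed_def zero_unitization_def)

lemma pos_elem_zero [simp]: "pos_elem 0"
  using pos_elem_square[of 0] by simp

lemma pos_elem_embed_sum:
  "(\<And>i. i \<in> I \<Longrightarrow> pos_elem (embed (f i))) \<Longrightarrow> pos_elem (embed (\<Sum>i\<in>I. f i))"
  by (induction I rule: infinite_finite_induct) (auto simp: embed_add pos_elem_add)

lemma scaleR_two_times: "(2 * r) *\<^sub>R x = r *\<^sub>R x + r *\<^sub>R (x :: 'a::real_vector)"
  and scaleR_times_two: "(r * 2) *\<^sub>R x = r *\<^sub>R x + r *\<^sub>R (x :: 'a::real_vector)"
  by (simp_all flip: scaleR_left.add)

text \<open>The roles are \<open>g = \<langle>x, x\<rangle>\<close>, \<open>b = \<langle>y, y\<rangle>\<close>, \<open>c = \<langle>y, x\<rangle>\<close>, and the positive element in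
  the hypothesis is \<open>\<langle>z, z\<rangle>\<close> for \<open>z = M x - y c\<close>. Adding \<open>adj c (M - b) c\<close>, positive once
  \<open>M \<ge> \<parallel>b\<parallel>\<close>, leaves \<open>M (adj c * c) \<le> M\<^sup>2 g\<close>. Taking \<open>M > \<parallel>b\<parallel>\<close> and then the limit
  covers the case \<open>b = 0\<close>.\<close>

lemma Cauchy_Schwarz_from_positivity:
  fixes g b c :: "'a::cstar_algebra"
  assumes b: "pos_elem (embed b)"
    and pos: "\<And>M. pos_elem (embed (M\<^sup>2 *\<^sub>R g - (2 * M) *\<^sub>R (adj c * c) + adj c * b * c))"
  shows "(norm c)\<^sup>2 \<le> norm g * norm b"
proof -
  have *: "(norm c)\<^sup>2 \<le> M * norm g" if M: "M > norm b" for M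
  proof -
    have M0: "M > 0" using M norm_ge_zero[of b] by linarith
    let ?G = "embed g" and ?B = "embed b" and ?C = "embed c"
    have "pos_elem (of_real M - ?B)"
      using M by (intro pos_elem_diff_of_real b) simp
    then have "pos_elem (adj ?C * (of_real M - ?B) * ?C)"
      by (rule pos_elem_conjugate)
    from pos_elem_add[OF pos[of M] this]
    have 1: "pos_elem (embed (M\<^sup>2 *\<^sub>R g - M *\<^sub>R (adj c * c)))"
      by (simp add: embed_add embed_diff embed_mult embed_scaleR embed_adj of_real_def
          scaleR_times_two algebra_simps del: scaleR_left_diff_distrib)
    have 2: "pos_elem (embed (M *\<^sub>R (adj c * c)))"
      unfolding embed_scaleR using M0 by (intro pos_elem_scaleR pos_elem_embed_star_square) simp
    have "norm (M *\<^sub>R (adj c * c)) \<le> norm (M\<^sup>2 *\<^sub>R g)"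
      using pos_elem_norm_mono[OF 2 1] by (simp flip: embed_add del: norm_scaleR)
    then have "M * (norm c)\<^sup>2 \<le> M * (M * norm g)"
      using M0 by (simp add: cstar_identity power2_eq_square)
    with M0 show ?thesis by simp
  qed
  have "((\<lambda>M. M * norm g) \<longlongrightarrow> norm b * norm g) (at_right (norm b))"
    by (intro tendsto_intros)
  then have "(norm c)\<^sup>2 \<le> norm b * norm g"
    by (rule tendsto_lowerbound)
      (auto simp: eventually_at_filter intro!: always_eventually *)
  then show ?thesis by (simp add: mult.commute)
qed

definition weighted_gram ::
  "(nat \<Rightarrow> real) \<Rightarrow> nat set \<Rightarrow> (nat \<Rightarrow> 'a) \<Rightarrow> (nat \<Rightarrow> 'a) \<Rightarrow> 'a::cstar_algebra"
  where "weighted_gram p I x y = (\<Sum>i\<in>I. p i *\<^sub>R (adj (x i) * y i))"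

lemma adj_weighted_gram: "adj (weighted_gram p I x y) = weighted_gram p I y x"
  by (simp add: weighted_gram_def adj_sum adj_scaleR adj_mult adj_adj)

lemma pos_elem_weighted_gram:
  assumes "\<And>i. i \<in> I \<Longrightarrow> 0 \<le> p i"
  shows "pos_elem (embed (weighted_gram p I x x))"
  unfolding weighted_gram_def
  by (intro pos_elem_embed_sum)
    (simp add: embed_scaleR pos_elem_scaleR pos_elem_embed_star_square assms)

lemma weighted_gram_diff:
  "weighted_gram p I (\<lambda>i. M *\<^sub>R x i - y i * c) (\<lambda>i. M *\<^sub>R x i - y i * c)
    = M\<^sup>2 *\<^sub>R weighted_gram p I x x
      - (M *\<^sub>R (weighted_gram p I x y * c) + M *\<^sub>R (adj c * weighted_gram p I y x))
      + adj c * weighted_gram p I y y * c"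
  by (simp add: weighted_gram_def adj_diff adj_scaleR adj_mult algebra_simps scaleR_sum_right
      sum_distrib_left sum_distrib_right sum.distrib sum_subtractf power2_eq_square)

lemma weighted_gram_Cauchy_Schwarz:
  assumes p: "\<And>i. i \<in> I \<Longrightarrow> 0 \<le> p i"
  shows "(norm (weighted_gram p I x y))\<^sup>2
    \<le> norm (weighted_gram p I x x) * norm (weighted_gram p I y y)"
proof -
  let ?c = "weighted_gram p I y x"
  have "(norm ?c)\<^sup>2 \<le> norm (weighted_gram p I x x) * norm (weighted_gram p I y y)"
  proof (rule Cauchy_Schwarz_from_positivity[OF pos_elem_weighted_gram[OF p]])
    fix M
    let ?z = "\<lambda>i. M *\<^sub>R x i - y i * ?c"
    have "weighted_gram p I ?z ?z = M\<^sup>2 *\<^sub>R weighted_gram p I x x - (2 * M) *\<^sub>R (adj ?c * ?c)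
      + adj ?c * weighted_gram p I y y * ?c"
      by (simp add: weighted_gram_diff adj_weighted_gram scaleR_two_times)
    then show "pos_elem (embed (M\<^sup>2 *\<^sub>R weighted_gram p I x x - (2 * M) *\<^sub>R (adj ?c * ?c)
      + adj ?c * weighted_gram p I y y * ?c))"
      using pos_elem_weighted_gram[of I p ?z, OF p] by simp
  qed auto
  then show ?thesis
    using norm_adj[of "weighted_gram p I y x"] by (simp add: adj_weighted_gram)
qed

context semi_inner_product_module
begin

lemma ip_zero_right [simp]: "ip x 0 = 0"
  using ip_add_right[of x 0 0] by simp

lemma ip_minus_right: "ip x (- y) = - ip x y"
  using ip_add_right[of x y "- y"] by (simp add: minus_unique)

lemma ip_diff_right: "ip x (y - z) = ip x y - ip x z"
  using ip_add_right[of x y "- z"] by (simp add: ip_minus_right)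

text \<open>The axioms give the compatibility of the form with complex scalars only after
  multiplication by an element of the algebra. Multiplying the difference \<open>d\<close> of the
  two sides by its own adjoint gives \<open>d = 0\<close>.\<close>

lemma ip_scaleC_right: "ip x (c *\<^sub>C y) = c *\<^sub>C ip x y"
proof -
  define d where "d = ip x (c *\<^sub>C y) - c *\<^sub>C ip x y"
  have "ip x (c *\<^sub>C y) * a = (c *\<^sub>C ip x y) * a" for a
  proof -
    have "ip x (c *\<^sub>C y) * a = ip x (act y (c *\<^sub>C a))"
      by (simp add: act_scaleC_left act_scaleC_right flip: ip_act_right)
    then show ?thesis by (simp add: ip_act_right mult_scaleC_left mult_scaleC_right)
  qed
  then have "d * adj d = 0" by (simp add: d_def left_diff_distrib)
  then have "adj d = 0" using adj_mult_self_eq_0[of "adj d"] by (simp add: adj_adj)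
  then have "norm d = 0" using norm_adj[of d] by simp
  then show ?thesis by (simp add: d_def)
qed

lemma ip_add_left: "ip (x + y) z = ip x z + ip y z"
  by (metis adj_ip adj_add ip_add_right)

lemma ip_diff_left: "ip (x - y) z = ip x z - ip y z"
  by (metis adj_ip adj_diff ip_diff_right)

lemma ip_act_left: "ip (act x a) y = adj a * ip x y"
  by (metis adj_ip adj_mult ip_act_right)

lemma ip_scaleC_left: "ip (c *\<^sub>C x) y = cnj c *\<^sub>C ip x y"
  by (metis adj_ip adj_scaleC ip_scaleC_right)

lemma ip_scaleR_right: "ip x (r *\<^sub>R y) = r *\<^sub>R ip x y"
  by (simp add: scaleR_scaleC ip_scaleC_right)

lemma ip_scaleR_left: "ip (r *\<^sub>R x) y = r *\<^sub>R ip x y"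
  by (simp add: scaleR_scaleC ip_scaleC_left)

lemma ip_Cauchy_Schwarz: "(norm (ip x y))\<^sup>2 \<le> norm (ip x x) * norm (ip y y)"
proof -
  have "(norm (ip y x))\<^sup>2 \<le> norm (ip x x) * norm (ip y y)"
  proof (rule Cauchy_Schwarz_from_positivity)
    show "pos_elem (embed (ip y y))" by (intro pos_elem_embed_cstar_nonneg ip_nonneg)
    fix M :: real
    let ?z = "M *\<^sub>R x - act y (ip y x)"
    have "ip ?z ?z = M\<^sup>2 *\<^sub>R ip x x - (2 * M) *\<^sub>R (adj (ip y x) * ip y x)
      + adj (ip y x) * ip y y * ip y x"
      by (simp add: ip_diff_left ip_diff_right ip_act_left ip_act_right ip_scaleR_left
          ip_scaleR_right adj_ip algebra_simps power2_eq_square scaleR_times_two)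
    then show "pos_elem (embed (M\<^sup>2 *\<^sub>R ip x x - (2 * M) *\<^sub>R (adj (ip y x) * ip y x)
      + adj (ip y x) * ip y y * ip y x))"
      using pos_elem_embed_cstar_nonneg[OF ip_nonneg[of ?z]] by simp
  qed
  then show ?thesis using norm_adj[of "ip x y"] by (simp add: adj_ip)
qed

lemma module_norm_triangle: "module_norm ip (x + y) \<le> module_norm ip x + module_norm ip y"
proof -
  have cs: "norm (ip u v) \<le> module_norm ip u * module_norm ip v" for u v
    unfolding module_norm_def using ip_Cauchy_Schwarz[of u v]
    by (metis real_le_rsqrt real_sqrt_mult)
  have "norm (ip (x + y) (x + y)) \<le> norm (ip x x) + norm (ip y x) + (norm (ip x y) + norm (ip y y))"
    unfolding ip_add_left ip_add_right
    by (intro norm_triangle_le add_mono norm_triangle_ineq order_refl)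
  also have "\<dots> \<le> module_norm ip x * module_norm ip x + module_norm ip y * module_norm ip x
      + (module_norm ip x * module_norm ip y + module_norm ip y * module_norm ip y)"
    by (intro add_mono cs)
  also have "\<dots> = (module_norm ip x + module_norm ip y)\<^sup>2"
    by (simp add: power2_eq_square algebra_simps)
  finally show ?thesis
    unfolding module_norm_def[of ip "x + y"]
    by (rule real_le_lsqrt[rotated -1]) (simp_all add: module_norm_def)
qed

lemma module_norm_scaleC: "module_norm ip (c *\<^sub>C x) = cmod c * module_norm ip x"
  by (simp add: module_norm_def ip_scaleC_left ip_scaleC_right scaleC_scaleC norm_scaleC norm_mult
      real_sqrt_mult)

lemma module_norm_sum_le: "module_norm ip (\<Sum>i\<in>I. x i) \<le> (\<Sum>i\<in>I. module_norm ip (x i))"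
proof (induction I rule: infinite_finite_induct)
  case (insert i I)
  then show ?case using module_norm_triangle[of "x i" "\<Sum>i\<in>I. x i"] by simp
qed (simp_all add: module_norm_def)

end

section \<open>Covariance bounds for probability weights\<close>

lemma weighted_gram_centred_right:
  fixes p :: "nat \<Rightarrow> real" and x y :: "nat \<Rightarrow> 'a::cstar_algebra" and c :: 'a
  assumes p: "(\<Sum>i\<in>I. p i) = 1"
  defines "m \<equiv> \<Sum>i\<in>I. p i *\<^sub>R y i"
  shows "weighted_gram p I (\<lambda>i. x i - c) (\<lambda>i. y i - m) = weighted_gram p I x (\<lambda>i. y i - m)"
proof -
  have "(\<Sum>i\<in>I. p i *\<^sub>R (y i - m)) = 0"
    using p by (simp add: scaleR_diff_right sum_subtractf m_def flip: scaleR_left.sum)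
  then have "(\<Sum>i\<in>I. p i *\<^sub>R (adj c * (y i - m))) = 0"
    by (simp flip: sum_distrib_left mult_scaleR_right)
  then show ?thesis
    by (simp add: weighted_gram_def adj_diff left_diff_distrib[of "adj _"] scaleR_diff_right sum_subtractf)
qed

text \<open>Centring is a self-adjoint projection for the form, and a self-adjoint projection is
  contractive by Cauchy-Schwarz alone.\<close>

lemma norm_centred_gram_le:
  fixes p :: "nat \<Rightarrow> real" and x :: "nat \<Rightarrow> 'a::cstar_algebra" and a :: 'a
  assumes p: "\<And>i. i \<in> I \<Longrightarrow> 0 \<le> p i" "(\<Sum>i\<in>I. p i) = 1"
    and r: "0 \<le> r" "\<And>i. i \<in> I \<Longrightarrow> norm (x i - a) \<le> r"
  defines "m \<equiv> \<Sum>i\<in>I. p i *\<^sub>R x i"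
  shows "norm (weighted_gram p I (\<lambda>i. x i - m) (\<lambda>i. x i - m)) \<le> r\<^sup>2"
proof -
  let ?xa = "\<lambda>i. x i - a" and ?xm = "\<lambda>i. x i - m"
  let ?V = "norm (weighted_gram p I ?xm ?xm)"
  have "weighted_gram p I ?xm ?xm = weighted_gram p I ?xa ?xm"
    using p(2) unfolding m_def by (simp add: weighted_gram_centred_right)
  then have "?V\<^sup>2 \<le> norm (weighted_gram p I ?xa ?xa) * ?V"
    using weighted_gram_Cauchy_Schwarz[of I p ?xa ?xm, OF p(1)] by simp
  then have "?V \<le> norm (weighted_gram p I ?xa ?xa)"
    by (cases "?V = 0") (auto simp: power2_eq_square)
  also have "\<dots> \<le> (\<Sum>i\<in>I. p i * r\<^sup>2)"
    unfolding weighted_gram_def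
    by (rule sum_norm_le) (use p r in \<open>auto simp: cstar_identity intro!: mult_left_mono power_mono\<close>)
  also have "\<dots> = r\<^sup>2" using p by (simp flip: sum_distrib_right)
  finally show ?thesis .
qed

theorem norm_weighted_covariance_le:
  fixes p :: "nat \<Rightarrow> real" and x y :: "nat \<Rightarrow> 'a::cstar_algebra" and a b :: 'a
  assumes p: "\<And>i. i \<in> I \<Longrightarrow> 0 \<le> p i" "(\<Sum>i\<in>I. p i) = 1"
    and r: "0 \<le> r" "\<And>i. i \<in> I \<Longrightarrow> norm (x i - a) \<le> r"
    and s: "0 \<le> s" "\<And>i. i \<in> I \<Longrightarrow> norm (y i - b) \<le> s"
  shows "norm ((\<Sum>i\<in>I. p i *\<^sub>R (adj (x i) * y i))
    - (\<Sum>i\<in>I. p i *\<^sub>R adj (x i)) * (\<Sum>i\<in>I. p i *\<^sub>R y i)) \<le> r * s"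
proof -
  let ?mx = "\<Sum>i\<in>I. p i *\<^sub>R x i" and ?my = "\<Sum>i\<in>I. p i *\<^sub>R y i"
  let ?x = "\<lambda>i. x i - ?mx" and ?y = "\<lambda>i. y i - ?my"
  have "(\<Sum>i\<in>I. p i *\<^sub>R (adj (x i) * y i)) - (\<Sum>i\<in>I. p i *\<^sub>R adj (x i)) * ?my
      = weighted_gram p I x ?y"
    by (simp add: weighted_gram_def right_diff_distrib scaleR_diff_right sum_subtractf sum_distrib_right)
  also have "\<dots> = weighted_gram p I ?x ?y"
    using p(2) by (simp add: weighted_gram_centred_right)
  finally have eq: "(\<Sum>i\<in>I. p i *\<^sub>R (adj (x i) * y i)) - (\<Sum>i\<in>I. p i *\<^sub>R adj (x i)) * ?my
      = weighted_gram p I ?x ?y" .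
  have "(norm (weighted_gram p I ?x ?y))\<^sup>2
      \<le> norm (weighted_gram p I ?x ?x) * norm (weighted_gram p I ?y ?y)"
    by (rule weighted_gram_Cauchy_Schwarz[OF p(1)])
  also have "\<dots> \<le> r\<^sup>2 * s\<^sup>2"
    by (intro mult_mono norm_centred_gram_le[OF p r] norm_centred_gram_le[OF p s]) auto
  finally have "(norm (weighted_gram p I ?x ?y))\<^sup>2 \<le> (r * s)\<^sup>2" by (simp add: power_mult_distrib)
  then show ?thesis unfolding eq by (rule power2_le_imp_le) (use r s in simp)
qed

lemma weighted_variance:
  fixes \<alpha> :: "nat \<Rightarrow> complex"
  assumes p: "(\<Sum>i\<in>I. p i) = 1"
  defines "m \<equiv> \<Sum>i\<in>I. of_real (p i) * \<alpha> i"
  shows "(\<Sum>i\<in>I. p i * (cmod (\<alpha> i - m))\<^sup>2) = (\<Sum>i\<in>I. p i * (cmod (\<alpha> i))\<^sup>2) - (cmod m)\<^sup>2"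
proof -
  have *: "p i * (cmod (\<alpha> i - m))\<^sup>2
      = p i * (cmod (\<alpha> i))\<^sup>2 - 2 * Re (cnj m * (of_real (p i) * \<alpha> i)) + p i * (cmod m)\<^sup>2" for i
    by (simp add: cmod_power2) (simp add: power2_eq_square algebra_simps)
  have "(\<Sum>i\<in>I. Re (cnj m * (of_real (p i) * \<alpha> i))) = Re (cnj m * m)"
    unfolding Re_sum[symmetric] sum_distrib_left[symmetric] m_def ..
  also have "\<dots> = (cmod m)\<^sup>2" by (simp add: cmod_power2) (simp add: power2_eq_square)
  finally show ?thesis
    unfolding * using p by (simp add: sum.distrib sum_subtractf flip: sum_distrib_left sum_distrib_right)
qed

text \<open>The variance of the deviations \<open>\<bar>\<alpha> i - m\<bar>\<close> is nonnegative.\<close>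

lemma weighted_mean_deviation_le:
  fixes \<alpha> :: "nat \<Rightarrow> complex"
  assumes p: "\<And>i. i \<in> I \<Longrightarrow> 0 \<le> p i" "(\<Sum>i\<in>I. p i) = 1"
  defines "m \<equiv> \<Sum>i\<in>I. of_real (p i) * \<alpha> i"
  shows "(\<Sum>i\<in>I. p i * cmod (\<alpha> i - m)) \<le> sqrt ((\<Sum>i\<in>I. p i * (cmod (\<alpha> i))\<^sup>2) - (cmod m)\<^sup>2)"
proof -
  define d where "d i = cmod (\<alpha> i - m)" for i
  have "0 \<le> (\<Sum>i\<in>I. p i * (cmod (of_real (d i) - (\<Sum>i\<in>I. of_real (p i) * of_real (d i))))\<^sup>2)"
    using p by (intro sum_nonneg) simp
  also have "\<dots> = (\<Sum>i\<in>I. p i * (d i)\<^sup>2) - (\<Sum>i\<in>I. p i * d i)\<^sup>2"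
    unfolding weighted_variance[OF p(2)] by (simp flip: of_real_mult of_real_sum)
  finally have "(\<Sum>i\<in>I. p i * d i)\<^sup>2 \<le> (\<Sum>i\<in>I. p i * (d i)\<^sup>2)" by simp
  then show ?thesis
    unfolding d_def m_def weighted_variance[OF p(2)] by (rule real_le_rsqrt)
qed

text \<open>The weights \<open>p i (\<alpha> i - m)\<close> sum to zero, so \<open>x i\<close> may be replaced by \<open>x i - a\<close>.\<close>

lemma (in semi_inner_product_module) module_norm_weighted_covariance_le:
  fixes \<alpha> :: "nat \<Rightarrow> complex" and x :: "nat \<Rightarrow> 'x"
  assumes p: "\<And>i. i \<in> I \<Longrightarrow> 0 \<le> p i" "(\<Sum>i\<in>I. p i) = 1"
    and r: "\<And>i. i \<in> I \<Longrightarrow> module_norm ip (x i - a) \<le> r"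
  defines "m \<equiv> \<Sum>i\<in>I. of_real (p i) * \<alpha> i"
  shows "module_norm ip ((\<Sum>i\<in>I. (of_real (p i) * \<alpha> i) *\<^sub>C x i) - m *\<^sub>C (\<Sum>i\<in>I. p i *\<^sub>R x i))
    \<le> r * (\<Sum>i\<in>I. p i * cmod (\<alpha> i - m))"
proof -
  have "(\<Sum>i\<in>I. of_real (p i) * (\<alpha> i - m)) = 0"
    unfolding right_diff_distrib sum_subtractf m_def[symmetric] sum_distrib_right[symmetric]
      of_real_sum[symmetric] p(2) by simp
  then have "(\<Sum>i\<in>I. (of_real (p i) * (\<alpha> i - m)) *\<^sub>C a) = 0"
    by (simp add: scaleC_zero_left flip: scaleC_sum_left)
  then have "(\<Sum>i\<in>I. (of_real (p i) * \<alpha> i) *\<^sub>C x i) - m *\<^sub>C (\<Sum>i\<in>I. p i *\<^sub>R x i)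
      = (\<Sum>i\<in>I. (of_real (p i) * (\<alpha> i - m)) *\<^sub>C (x i - a))"
    by (simp add: scaleC_diff_right sum_subtractf)
      (simp add: algebra_simps scaleC_diff_left sum_subtractf scaleC_sum_right scaleR_scaleC scaleC_scaleC)
  also have "module_norm ip \<dots> \<le> (\<Sum>i\<in>I. module_norm ip ((of_real (p i) * (\<alpha> i - m)) *\<^sub>C (x i - a)))"
    by (rule module_norm_sum_le)
  also have "\<dots> \<le> (\<Sum>i\<in>I. p i * cmod (\<alpha> i - m) * r)"
    using p(1) r by (intro sum_mono) (simp add: module_norm_scaleC norm_mult mult_left_mono)
  also have "\<dots> = r * (\<Sum>i\<in>I. p i * cmod (\<alpha> i - m))"
    by (simp add: sum_distrib_left mult.commute)
  finally show ?thesis .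
qed

section \<open>Sharpness\<close>

lemma complex_semi_inner_product_module:
  "semi_inner_product_module (\<lambda>x a :: complex. x * a) (\<lambda>x y :: complex. cnj x * y)"
  by standard (auto simp: algebra_simps scaleC_complex_def adj_complex_def cstar_nonneg_def)

lemma two_point_weights: "probability_vector 2 (\<lambda>i. 1/2)"
  by (simp add: probability_vector_def)

lemma sum_two_points: "(\<Sum>i=Suc 0..2. f i) = f 1 + f (2::nat)"
  by (simp add: numeral_2_eq_2)

theorem mainTheorem3:
  fixes n :: nat and p :: "nat \<Rightarrow> real"
  assumes "probability_vector n p"
  shows
    "(\<forall>(a :: 'a::cstar_algebra) (b :: 'a) (as :: nat \<Rightarrow> 'a) (bs :: nat \<Rightarrow> 'a) (r :: real) (s :: real).
        0 \<le> r \<longrightarrow> 0 \<le> s \<longrightarrow>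
        (\<forall>i\<in>{1..n}. norm (as i - a) \<le> r) \<longrightarrow>
        (\<forall>i\<in>{1..n}. norm (bs i - b) \<le> s) \<longrightarrow>
        norm ((\<Sum>i=1..n. p i *\<^sub>R (adj (as i) * bs i))
              - (\<Sum>i=1..n. p i *\<^sub>R adj (as i)) * (\<Sum>i=1..n. p i *\<^sub>R bs i)) \<le> r * s \<and>
        norm ((\<Sum>i=1..n. p i *\<^sub>R (as i * bs i))
              - (\<Sum>i=1..n. p i *\<^sub>R as i) * (\<Sum>i=1..n. p i *\<^sub>R bs i)) \<le> r * s)
     \<and>
     (\<forall>K \<in> {UNIV, \<real>}.
      \<forall>(act :: 'x::complex_vector \<Rightarrow> 'a \<Rightarrow> 'x) (ip :: 'x \<Rightarrow> 'x \<Rightarrow> 'a)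
         (a :: 'x) (\<alpha> :: nat \<Rightarrow> complex) (x :: nat \<Rightarrow> 'x) (r :: real).
        semi_inner_product_module act ip \<longrightarrow>
        (\<forall>i\<in>{1..n}. \<alpha> i \<in> K) \<longrightarrow>
        0 \<le> r \<longrightarrow>
        (\<forall>i\<in>{1..n}. module_norm ip (x i - a) \<le> r) \<longrightarrow>
        module_norm ip ((\<Sum>i=1..n. (of_real (p i) * \<alpha> i) *\<^sub>C x i)
              - (\<Sum>i=1..n. of_real (p i) * \<alpha> i) *\<^sub>C (\<Sum>i=1..n. p i *\<^sub>R x i))
          \<le> r * (\<Sum>i=1..n. p i * cmod (\<alpha> i - (\<Sum>j=1..n. of_real (p j) * \<alpha> j))) \<and>
        r * (\<Sum>i=1..n. p i * cmod (\<alpha> i - (\<Sum>j=1..n. of_real (p j) * \<alpha> j)))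
          \<le> r * sqrt ((\<Sum>i=1..n. p i * (cmod (\<alpha> i))\<^sup>2)
                       - (cmod (\<Sum>i=1..n. of_real (p i) * \<alpha> i))\<^sup>2))
     \<and>
     (\<forall>K \<in> {UNIV, \<real>}.
      \<not> (\<exists>c<1.
        \<forall>(act :: complex \<Rightarrow> complex \<Rightarrow> complex) (ip :: complex \<Rightarrow> complex \<Rightarrow> complex)
          (m :: nat) (q :: nat \<Rightarrow> real)
          (a :: complex) (\<alpha> :: nat \<Rightarrow> complex) (x :: nat \<Rightarrow> complex) (r :: real).
        semi_inner_product_module act ip \<longrightarrow>
        1 \<le> m \<longrightarrow>
        probability_vector m q \<longrightarrow>
        (\<forall>i\<in>{1..m}. \<alpha> i \<in> K) \<longrightarrow>
        0 \<le> r \<longrightarrow>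
        (\<forall>i\<in>{1..m}. module_norm ip (x i - a) \<le> r) \<longrightarrow>
        module_norm ip ((\<Sum>i=1..m. (of_real (q i) * \<alpha> i) *\<^sub>C x i)
              - (\<Sum>i=1..m. of_real (q i) * \<alpha> i) *\<^sub>C (\<Sum>i=1..m. q i *\<^sub>R x i))
          \<le> c * (r * (\<Sum>i=1..m. q i * cmod (\<alpha> i - (\<Sum>j=1..m. of_real (q j) * \<alpha> j))))))
     \<and>
     (\<forall>K \<in> {UNIV, \<real>}.
      \<not> (\<exists>c<1.
        \<forall>(act :: complex \<Rightarrow> complex \<Rightarrow> complex) (ip :: complex \<Rightarrow> complex \<Rightarrow> complex)
          (m :: nat) (q :: nat \<Rightarrow> real)
          (a :: complex) (\<alpha> :: nat \<Rightarrow> complex) (x :: nat \<Rightarrow> complex) (r :: real).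
        semi_inner_product_module act ip \<longrightarrow>
        1 \<le> m \<longrightarrow>
        probability_vector m q \<longrightarrow>
        (\<forall>i\<in>{1..m}. \<alpha> i \<in> K) \<longrightarrow>
        0 \<le> r \<longrightarrow>
        (\<forall>i\<in>{1..m}. module_norm ip (x i - a) \<le> r) \<longrightarrow>
        r * (\<Sum>i=1..m. q i * cmod (\<alpha> i - (\<Sum>j=1..m. of_real (q j) * \<alpha> j)))
          \<le> c * (r * sqrt ((\<Sum>i=1..m. q i * (cmod (\<alpha> i))\<^sup>2)
                            - (cmod (\<Sum>i=1..m. of_real (q i) * \<alpha> i))\<^sup>2))))"
proof (intro conjI)
  have p: "\<And>i. i \<in> {1..n} \<Longrightarrow> 0 \<le> p i" "(\<Sum>i=1..n. p i) = 1"
    using assms by (auto simp: probability_vector_def)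
  show "\<forall>(a :: 'a) b as bs r s. 0 \<le> r \<longrightarrow> 0 \<le> s \<longrightarrow>
        (\<forall>i\<in>{1..n}. norm (as i - a) \<le> r) \<longrightarrow> (\<forall>i\<in>{1..n}. norm (bs i - b) \<le> s) \<longrightarrow>
        norm ((\<Sum>i=1..n. p i *\<^sub>R (adj (as i) * bs i))
              - (\<Sum>i=1..n. p i *\<^sub>R adj (as i)) * (\<Sum>i=1..n. p i *\<^sub>R bs i)) \<le> r * s \<and>
        norm ((\<Sum>i=1..n. p i *\<^sub>R (as i * bs i))
              - (\<Sum>i=1..n. p i *\<^sub>R as i) * (\<Sum>i=1..n. p i *\<^sub>R bs i)) \<le> r * s"
  proof (intro allI impI)
    fix a b :: 'a and as bs :: "nat \<Rightarrow> 'a" and r s :: real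
    assume *: "0 \<le> r" "0 \<le> s" "\<forall>i\<in>{1..n}. norm (as i - a) \<le> r" "\<forall>i\<in>{1..n}. norm (bs i - b) \<le> s"
    have "norm (adj (as i) - adj a) = norm (as i - a)" for i
      by (simp flip: adj_diff)
    with * show "norm ((\<Sum>i=1..n. p i *\<^sub>R (adj (as i) * bs i))
              - (\<Sum>i=1..n. p i *\<^sub>R adj (as i)) * (\<Sum>i=1..n. p i *\<^sub>R bs i)) \<le> r * s \<and>
        norm ((\<Sum>i=1..n. p i *\<^sub>R (as i * bs i))
              - (\<Sum>i=1..n. p i *\<^sub>R as i) * (\<Sum>i=1..n. p i *\<^sub>R bs i)) \<le> r * s"
      using norm_weighted_covariance_le[of "{1..n}" p r as a s bs b, OF p]
        norm_weighted_covariance_le[of "{1..n}" p r "\<lambda>i. adj (as i)" "adj a" s bs b, OF p]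
      by (simp add: adj_adj)
  qed
  show "\<forall>K \<in> {UNIV, \<real>}.
      \<forall>(act :: 'x::complex_vector \<Rightarrow> 'a \<Rightarrow> 'x) (ip :: 'x \<Rightarrow> 'x \<Rightarrow> 'a)
         (a :: 'x) (\<alpha> :: nat \<Rightarrow> complex) (x :: nat \<Rightarrow> 'x) (r :: real).
        semi_inner_product_module act ip \<longrightarrow>
        (\<forall>i\<in>{1..n}. \<alpha> i \<in> K) \<longrightarrow>
        0 \<le> r \<longrightarrow>
        (\<forall>i\<in>{1..n}. module_norm ip (x i - a) \<le> r) \<longrightarrow>
        module_norm ip ((\<Sum>i=1..n. (of_real (p i) * \<alpha> i) *\<^sub>C x i)
              - (\<Sum>i=1..n. of_real (p i) * \<alpha> i) *\<^sub>C (\<Sum>i=1..n. p i *\<^sub>R x i))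
          \<le> r * (\<Sum>i=1..n. p i * cmod (\<alpha> i - (\<Sum>j=1..n. of_real (p j) * \<alpha> j))) \<and>
        r * (\<Sum>i=1..n. p i * cmod (\<alpha> i - (\<Sum>j=1..n. of_real (p j) * \<alpha> j)))
          \<le> r * sqrt ((\<Sum>i=1..n. p i * (cmod (\<alpha> i))\<^sup>2)
                       - (cmod (\<Sum>i=1..n. of_real (p i) * \<alpha> i))\<^sup>2)"
    using p
    by (intro ballI allI impI conjI semi_inner_product_module.module_norm_weighted_covariance_le
        mult_left_mono weighted_mean_deviation_le) blast+
  \<comment> \<open>at two equal weights both inequalities become \<open>1 \<le> c * 1\<close> for \<open>\<alpha> = x = ?\<epsilon>\<close>, \<open>a = 0\<close>, \<open>r = 1\<close>\<close>
  let ?\<epsilon> = "\<lambda>i::nat. if i = 1 then 1 else - 1 :: complex"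
  have norm_\<epsilon>: "module_norm (\<lambda>x y :: complex. cnj x * y) (?\<epsilon> i - 0) \<le> 1" for i
    by (simp add: module_norm_def)
  show "\<forall>K \<in> {UNIV, \<real>}.
      \<not> (\<exists>c<1.
        \<forall>(act :: complex \<Rightarrow> complex \<Rightarrow> complex) (ip :: complex \<Rightarrow> complex \<Rightarrow> complex)
          (m :: nat) (q :: nat \<Rightarrow> real)
          (a :: complex) (\<alpha> :: nat \<Rightarrow> complex) (x :: nat \<Rightarrow> complex) (r :: real).
        semi_inner_product_module act ip \<longrightarrow>
        1 \<le> m \<longrightarrow>
        probability_vector m q \<longrightarrow>
        (\<forall>i\<in>{1..m}. \<alpha> i \<in> K) \<longrightarrow>
        0 \<le> r \<longrightarrow>
        (\<forall>i\<in>{1..m}. module_norm ip (x i - a) \<le> r) \<longrightarrow>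
        module_norm ip ((\<Sum>i=1..m. (of_real (q i) * \<alpha> i) *\<^sub>C x i)
              - (\<Sum>i=1..m. of_real (q i) * \<alpha> i) *\<^sub>C (\<Sum>i=1..m. q i *\<^sub>R x i))
          \<le> c * (r * (\<Sum>i=1..m. q i * cmod (\<alpha> i - (\<Sum>j=1..m. of_real (q j) * \<alpha> j)))))"
  proof (intro ballI notI, elim exE conjE)
    fix K :: "complex set" and c :: real
    assume K: "K \<in> {UNIV, \<real>}" and c: "c < 1"
    assume bound [rule_format]: "\<forall>(act :: complex \<Rightarrow> complex \<Rightarrow> complex) (ip :: complex \<Rightarrow> complex \<Rightarrow> complex)
          m q (a :: complex) \<alpha> x r.
        semi_inner_product_module act ip \<longrightarrow> 1 \<le> m \<longrightarrow> probability_vector m q \<longrightarrow>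
        (\<forall>i\<in>{1..m}. \<alpha> i \<in> K) \<longrightarrow> 0 \<le> r \<longrightarrow>
        (\<forall>i\<in>{1..m}. module_norm ip (x i - a) \<le> r) \<longrightarrow>
        module_norm ip ((\<Sum>i=1..m. (of_real (q i) * \<alpha> i) *\<^sub>C x i)
              - (\<Sum>i=1..m. of_real (q i) * \<alpha> i) *\<^sub>C (\<Sum>i=1..m. q i *\<^sub>R x i))
          \<le> c * (r * (\<Sum>i=1..m. q i * cmod (\<alpha> i - (\<Sum>j=1..m. of_real (q j) * \<alpha> j))))"
    have "?\<epsilon> i \<in> K" for i using K by auto
    note ineq = bound[of "\<lambda>x a. x * a" "\<lambda>x y. cnj x * y" 2 "\<lambda>i. 1/2" ?\<epsilon> 1 ?\<epsilon> 0,
        OF complex_semi_inner_product_module one_le_numeral two_point_weights this zero_le_one norm_\<epsilon>]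
    have "1 \<le> c"
      using ineq
      by (auto simp: sum_two_points scaleC_complex_def module_norm_def)
    with c show False by simp
  qed
  show "\<forall>K \<in> {UNIV, \<real>}.
      \<not> (\<exists>c<1.
        \<forall>(act :: complex \<Rightarrow> complex \<Rightarrow> complex) (ip :: complex \<Rightarrow> complex \<Rightarrow> complex)
          (m :: nat) (q :: nat \<Rightarrow> real)
          (a :: complex) (\<alpha> :: nat \<Rightarrow> complex) (x :: nat \<Rightarrow> complex) (r :: real).
        semi_inner_product_module act ip \<longrightarrow>
        1 \<le> m \<longrightarrow>
        probability_vector m q \<longrightarrow>
        (\<forall>i\<in>{1..m}. \<alpha> i \<in> K) \<longrightarrow>
        0 \<le> r \<longrightarrow>
        (\<forall>i\<in>{1..m}. module_norm ip (x i - a) \<le> r) \<longrightarrow>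
        r * (\<Sum>i=1..m. q i * cmod (\<alpha> i - (\<Sum>j=1..m. of_real (q j) * \<alpha> j)))
          \<le> c * (r * sqrt ((\<Sum>i=1..m. q i * (cmod (\<alpha> i))\<^sup>2)
                            - (cmod (\<Sum>i=1..m. of_real (q i) * \<alpha> i))\<^sup>2)))"
  proof (intro ballI notI, elim exE conjE)
    fix K :: "complex set" and c :: real
    assume K: "K \<in> {UNIV, \<real>}" and c: "c < 1"
    assume bound [rule_format]: "\<forall>(act :: complex \<Rightarrow> complex \<Rightarrow> complex) (ip :: complex \<Rightarrow> complex \<Rightarrow> complex)
          m q (a :: complex) \<alpha> x r.
        semi_inner_product_module act ip \<longrightarrow> 1 \<le> m \<longrightarrow> probability_vector m q \<longrightarrow>
        (\<forall>i\<in>{1..m}. \<alpha> i \<in> K) \<longrightarrow> 0 \<le> r \<longrightarrow>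
        (\<forall>i\<in>{1..m}. module_norm ip (x i - a) \<le> r) \<longrightarrow>
        r * (\<Sum>i=1..m. q i * cmod (\<alpha> i - (\<Sum>j=1..m. of_real (q j) * \<alpha> j)))
          \<le> c * (r * sqrt ((\<Sum>i=1..m. q i * (cmod (\<alpha> i))\<^sup>2)
                            - (cmod (\<Sum>i=1..m. of_real (q i) * \<alpha> i))\<^sup>2))"
    have "?\<epsilon> i \<in> K" for i using K by auto
    note ineq = bound[of "\<lambda>x a. x * a" "\<lambda>x y. cnj x * y" 2 "\<lambda>i. 1/2" ?\<epsilon> 1 ?\<epsilon> 0,
        OF complex_semi_inner_product_module one_le_numeral two_point_weights this zero_le_one norm_\<epsilon>]
    have "1 \<le> c"
      using ineq
      by (auto simp: sum_two_points module_norm_def)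
    with c show False by simp
  qed
qed

end
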